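(* For all $n\ge2$ and $t\ge1$, $$\mathcal{F}^+_t(\mathcal{C}^p_{2n})=\mathcal{F}_t(\mathcal{C}_{2n-2}),$$ i.e. the parity-restricted frame potential of the p-Clifford group on $2n$ Majorana modes equals the ordinary frame potential of the Majorana Clifford group on $2n-2$ modes (acting on a $2^{n-1}$-dimensional Hilbert space).
   Context: Majorana strings: for $m$ Hermitian operators $\chi_1,\dots,\chi_{2m}$ on a $2^m$-dimensional Hilbert space with $\chi_i\chi_k+\chi_k\chi_i=2\delta_{ik}I$, and $\omega_L$ the strictly lower triangular binary matrix of ones below the diagonal, $\mu(v)=i^{\,v^T\omega_L v}\chi_1^{v_1}\cdots\chi_{2m}^{v_{2m}}$ for $v\in\mathbb{F}_2^{2m}$. The Majorana Clifford group $\mathcal{C}_{2m}$ is the group of unitaries $\gamma$ with $\gamma\mu(v)\gamma^\dagger=c(v)\mu(S(v))$ for all $v$ (some $c,S$). With $j=(1,\dots,1)^T$, the p-Clifford group is $\mathcal{C}^p_{2m}=\{\gamma\in\mathcal{C}_{2m}:\gamma\mu(j)=\mu(j)\gamma\}$, and $\Pi_+=\frac12(I+\mu(j))$. Frame potentials, with expectations uniform over the group modulo global phases: $\mathcal{F}_t(\mathcal{G})=\mathbb{E}_{U,V\in\mathcal{G}}|\operatorname{tr}(UV^\dagger)|^{2t}$ and $\mathcal{F}^+_t(\mathcal{G})=\mathbb{E}_{U,V\in\mathcal{G}}|\operatorname{tr}(\Pi_+UV^\dagger)|^{2t}$. *)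

theory Defs
  imports Complex_Main "Jordan_Normal_Form.Matrix"
begin

definition adj :: "complex mat \<Rightarrow> complex mat" where
  "adj A = mat (dim_col A) (dim_row A) (\<lambda>(i,j). cnj (A $$ (j,i)))"

definition tr :: "complex mat \<Rightarrow> complex" where
  "tr A = (\<Sum>i<dim_row A. A $$ (i,i))"

definition unitary_mat :: "nat \<Rightarrow> complex mat \<Rightarrow> bool" where
  "unitary_mat N U \<longleftrightarrow> U \<in> carrier_mat N N \<and> U * adj U = 1\<^sub>m N \<and> adj U * U = 1\<^sub>m N"

definition majorana_family :: "nat \<Rightarrow> (nat \<Rightarrow> complex mat) \<Rightarrow> bool" where
  "majorana_family m chi \<longleftrightarrow>
     (\<forall>i\<in>{1..2*m}. chi i \<in> carrier_mat (2^m) (2^m) \<and> adj (chi i) = chi i) \<and>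
     (\<forall>i\<in>{1..2*m}. \<forall>k\<in>{1..2*m}.
        chi i * chi k + chi k * chi i = (if i = k then 2 \<cdot>\<^sub>m 1\<^sub>m (2^m) else 0\<^sub>m (2^m) (2^m)))"

text \<open>Binary vectors v in F_2^(2m) are functions nat => bool, where only the
  entries v 1, ..., v (2m) matter.  The exponent v^T omega_L v counts the pairs
  k < i (both in 1..2m) with v i = v k = 1.\<close>
definition omegaL_form :: "nat \<Rightarrow> (nat \<Rightarrow> bool) \<Rightarrow> nat" where
  "omegaL_form m v = card {(i,k). i \<in> {1..2*m} \<and> k \<in> {1..2*m} \<and> k < i \<and> v i \<and> v k}"

definition majorana_string :: "nat \<Rightarrow> (nat \<Rightarrow> complex mat) \<Rightarrow> (nat \<Rightarrow> bool) \<Rightarrow> complex mat" where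
  "majorana_string m chi v =
     \<i> ^ omegaL_form m v \<cdot>\<^sub>m
       foldl (\<lambda>P i. if v i then P * chi i else P) (1\<^sub>m (2^m)) [1..<2*m+1]"

definition majorana_clifford :: "nat \<Rightarrow> (nat \<Rightarrow> complex mat) \<Rightarrow> complex mat set" where
  "majorana_clifford m chi = {g. unitary_mat (2^m) g \<and>
     (\<exists>c :: (nat \<Rightarrow> bool) \<Rightarrow> complex. \<exists>S :: (nat \<Rightarrow> bool) \<Rightarrow> (nat \<Rightarrow> bool).
        \<forall>v. g * majorana_string m chi v * adj g = c v \<cdot>\<^sub>m majorana_string m chi (S v))}"

definition all_ones :: "nat \<Rightarrow> bool" where "all_ones = (\<lambda>_. True)"

definition p_clifford :: "nat \<Rightarrow> (nat \<Rightarrow> complex mat) \<Rightarrow> complex mat set" where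
  "p_clifford m chi = {g \<in> majorana_clifford m chi.
      g * majorana_string m chi all_ones = majorana_string m chi all_ones * g}"

definition Pi_plus :: "nat \<Rightarrow> (nat \<Rightarrow> complex mat) \<Rightarrow> complex mat" where
  "Pi_plus m chi = (1/2 :: complex) \<cdot>\<^sub>m (1\<^sub>m (2^m) + majorana_string m chi all_ones)"

definition phase_classes :: "complex mat set \<Rightarrow> complex mat set set" where
  "phase_classes G = (\<lambda>U. {c \<cdot>\<^sub>m U | c. cmod c = 1}) ` G"

text \<open>Uniform expectation over pairs of classes [U],[V] of f(U V^dagger),
  f phase-insensitive (evaluated on arbitrary representatives).\<close>
definition frame_avg :: "complex mat set \<Rightarrow> (complex mat \<Rightarrow> real) \<Rightarrow> real" where
  "frame_avg G f = (\<Sum>A\<in>phase_classes G. \<Sum>B\<in>phase_classes G.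
       f ((SOME U. U \<in> A) * adj (SOME V. V \<in> B))) / real (card (phase_classes G))^2"

definition frame_potential :: "nat \<Rightarrow> complex mat set \<Rightarrow> real" where
  "frame_potential t G = frame_avg G (\<lambda>W. cmod (tr W) ^ (2*t))"

definition frame_potential_plus :: "nat \<Rightarrow> complex mat \<Rightarrow> complex mat set \<Rightarrow> real" where
  "frame_potential_plus t P G = frame_avg G (\<lambda>W. cmod (tr (P * W)) ^ (2*t))"

end

theory Submission
  imports Defs "Jordan_Normal_Form.Determinant"
begin

text \<open>On the even-parity sector the operators \<open>B\<^sub>i = i \<chi>\<^sub>i \<chi>\<^sub>2\<^sub>n\<close> with \<open>i \<le> 2n - 2\<close> form a Majorana family
  in dimension \<open>2\<^sup>n\<^sup>-\<^sup>1\<close>, so there is an isometry \<open>W\<close> onto the sector with \<open>W W\<^sup>\<dagger> = \<Pi>\<^sub>+\<close> and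
  \<open>B\<^sub>i W = W \<chi>'\<^sub>i\<close>. Compression \<open>U \<mapsto> W\<^sup>\<dagger> U W\<close> is a homomorphism from the p-Clifford group on \<open>2n\<close>
  modes to the Clifford group on \<open>2n - 2\<close> modes, and \<open>tr (\<Pi>\<^sub>+ U V\<^sup>\<dagger>)\<close> is the trace of the compression
  of \<open>U V\<^sup>\<dagger>\<close>. It is surjective because \<open>\<chi>\<^sub>2\<^sub>n\<^sub>-\<^sub>1\<close> commutes with all \<open>B\<^sub>i\<close> and exchanges the two parity
  sectors, so \<open>W h W\<^sup>\<dagger> + \<chi>\<^sub>2\<^sub>n\<^sub>-\<^sub>1 W h W\<^sup>\<dagger> \<chi>\<^sub>2\<^sub>n\<^sub>-\<^sub>1\<close> is a preimage of \<open>h\<close>. A surjective homomorphism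
  of finite groups preserves uniform averages.

  Clifford operators are handled through a basis-free description: up to scalars, the Majorana
  strings are exactly the operators that commute up to sign with every \<open>\<chi>\<^sub>i\<close>.\<close>

section \<open>Matrices\<close>

text \<open>Compression has a kernel: the parity itself acts as the identity on the even sector. The
  two groups modulo phases therefore have different orders, and the averages can only be compared
  fibre by fibre. The isometry is where uniqueness of the irreducible representation of the Majorana
  relations enters. It rests on a count: a matrix in dimension 2^m has 4^m entries, exactly as many
  as there are strings, and the strings are orthogonal for the trace form. So they form a basis, and
  an operator commuting with all generators is scalar. This makes any nonzero intertwiner a multiple
  of an isometry, and since Pi_+ has trace 2^(n-1), the isometry fills the whole sector. Working
  with operators up to scalars and signs, instead of the maps c and S of the definition, keeps the
  phases of the strings out of the group-theoretic arguments.\<close>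

text \<open>With side conditions on dimensions instead of carriers, these rules have no free variables
  in their premises and work as rewrite rules.\<close>
lemma mat_mult_assoc_dim:
  fixes A B C :: "complex mat"
  assumes "dim_col A = dim_row B" "dim_col B = dim_row C"
  shows "A * B * C = A * (B * C)"
  using assms by (intro assoc_mult_mat[of A "dim_row A" "dim_col A" B "dim_col B" C "dim_col C"]) auto

lemma smult_mult_left_dim:
  fixes A B :: "complex mat"
  assumes "dim_col A = dim_row B"
  shows "(c \<cdot>\<^sub>m A) * B = c \<cdot>\<^sub>m (A * B)"
  using assms by (intro mult_smult_assoc_mat[of A "dim_row A" "dim_col A" B "dim_col B"]) auto

lemma smult_mult_right_dim:
  fixes A B :: "complex mat"
  assumes "dim_col A = dim_row B"
  shows "A * (c \<cdot>\<^sub>m B) = c \<cdot>\<^sub>m (A * B)"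
  using assms by (intro mult_smult_distrib[of A "dim_row A" "dim_col A" B "dim_col B"]) auto

lemma smult_smult_mat:
  fixes A :: "complex mat"
  shows "c \<cdot>\<^sub>m (d \<cdot>\<^sub>m A) = (c * d) \<cdot>\<^sub>m A"
  by (rule eq_matI) auto

lemma one_smult_mat:
  fixes A :: "complex mat"
  shows "1 \<cdot>\<^sub>m A = A"
  by (rule eq_matI) auto

lemma add_mult_dim:
  fixes A B C :: "complex mat"
  assumes "dim_col A = dim_row C" "dim_col B = dim_row C" "dim_row A = dim_row B"
  shows "(A + B) * C = A * C + B * C"
  using assms
  by (intro add_mult_distrib_mat[of A "dim_row A" "dim_col A" B C "dim_col C"]) auto

lemma mult_add_dim:
  fixes A B C :: "complex mat"
  assumes "dim_col A = dim_row B" "dim_row C = dim_row B" "dim_col C = dim_col B"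
  shows "A * (B + C) = A * B + A * C"
  using assms
  by (intro mult_add_distrib_mat[of A "dim_row A" "dim_col A" B "dim_col B"]) auto

lemma smult_add_dim:
  fixes A B :: "complex mat"
  assumes "dim_row A = dim_row B" "dim_col A = dim_col B"
  shows "c \<cdot>\<^sub>m (A + B) = c \<cdot>\<^sub>m A + c \<cdot>\<^sub>m B"
  using assms by (intro eq_matI) (auto simp: algebra_simps)

lemma dim_adj [simp]: "dim_row (adj A) = dim_col A" "dim_col (adj A) = dim_row A"
  by (simp_all add: adj_def)

lemma adj_carrier [simp]: "A \<in> carrier_mat r c \<Longrightarrow> adj A \<in> carrier_mat c r"
  by (simp add: adj_def)

lemma index_adj [simp]: "i < dim_col A \<Longrightarrow> j < dim_row A \<Longrightarrow> adj A $$ (i,j) = cnj (A $$ (j,i))"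
  by (simp add: adj_def)

lemma adj_adj [simp]: "adj (adj A) = A"
  by (rule eq_matI) auto

lemma adj_smult: "adj (c \<cdot>\<^sub>m A) = cnj c \<cdot>\<^sub>m adj A"
  by (rule eq_matI) auto

lemma adj_one [simp]: "adj (1\<^sub>m n) = 1\<^sub>m n"
  by (rule eq_matI) auto

lemma adj_add:
  "dim_row A = dim_row B \<Longrightarrow> dim_col A = dim_col B \<Longrightarrow> adj (A + B) = adj A + adj B"
  by (rule eq_matI) auto

lemma index_mult_sum:
  fixes A B :: "complex mat"
  assumes "i < dim_row A" "j < dim_col B" "dim_col A = dim_row B"
  shows "(A * B) $$ (i,j) = (\<Sum>k<dim_row B. A $$ (i,k) * B $$ (k,j))"
  using assms by (simp add: scalar_prod_def atLeast0LessThan)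

lemma adj_mult:
  assumes "dim_col A = dim_row B"
  shows "adj (A * B) = adj B * adj A"
proof (rule eq_matI)
  fix i j assume "i < dim_row (adj B * adj A)" "j < dim_col (adj B * adj A)"
  then have ij: "i < dim_col B" "j < dim_row A" by auto
  show "adj (A * B) $$ (i, j) = (adj B * adj A) $$ (i, j)"
    using ij assms by (simp add: index_mult_sum del: index_mult_mat(1)) (simp add: mult.commute)
qed (use assms in auto)

lemmas mat_simps = mat_mult_assoc_dim smult_mult_left_dim smult_mult_right_dim
  smult_smult_mat one_smult_mat adj_mult adj_smult

lemma tr_mult_comm:
  assumes "dim_col A = dim_row B" "dim_col B = dim_row A"
  shows "tr (A * B) = tr (B * A)"
proof -
  have "tr (A * B) = (\<Sum>i<dim_row A. \<Sum>k<dim_row B. A $$ (i,k) * B $$ (k,i))"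
    using assms by (simp add: tr_def index_mult_sum del: index_mult_mat(1))
  also have "\<dots> = (\<Sum>k<dim_row B. \<Sum>i<dim_row A. B $$ (k,i) * A $$ (i,k))"
    by (subst sum.swap) (simp add: mult.commute)
  also have "\<dots> = tr (B * A)"
    using assms by (simp add: tr_def index_mult_sum del: index_mult_mat(1))
  finally show ?thesis .
qed

lemma tr_smult: "dim_col A = dim_row A \<Longrightarrow> tr (c \<cdot>\<^sub>m A) = c * tr A"
  by (simp add: tr_def sum_distrib_left)

lemma tr_add: "A \<in> carrier_mat k k \<Longrightarrow> B \<in> carrier_mat k k \<Longrightarrow> tr (A + B) = tr A + tr B"
  by (simp add: tr_def sum.distrib)

lemma tr_one [simp]: "tr (1\<^sub>m k) = of_nat k"
  by (simp add: tr_def)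

section \<open>Positivity of the trace form, and unitary matrices\<close>

lemma tr_adj_mult_eq_sum:
  "tr (adj A * A) = of_real (\<Sum>i<dim_col A. \<Sum>k<dim_row A. (cmod (A $$ (k,i)))\<^sup>2)"
proof -
  have "cnj z * z = of_real ((cmod z)\<^sup>2)" for z
    by (metis complex_norm_square mult.commute)
  then show ?thesis
    by (simp add: tr_def index_mult_sum del: index_mult_mat(1))
qed

text \<open>Definiteness of the trace form. It serves to see that a nonzero intertwiner has positive
  norm and that a Hermitian idempotent of trace 0 vanishes.\<close>

lemma tr_adj_mult_eq_0:
  assumes "A \<in> carrier_mat r c" "tr (adj A * A) = 0"
  shows "A = 0\<^sub>m r c"
proof -
  have "(\<Sum>i<c. \<Sum>k<r. (cmod (A $$ (k,i)))\<^sup>2) = 0"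
    using assms by (simp add: tr_adj_mult_eq_sum flip: of_real_power of_real_sum)
  then have "\<forall>i<c. \<forall>k<r. A $$ (k,i) = 0"
    by (simp add: sum_nonneg sum_nonneg_eq_0_iff)
  then show ?thesis using assms by (intro eq_matI) auto
qed

lemma unitary_matD:
  assumes "unitary_mat N U"
  shows "U \<in> carrier_mat N N" "dim_row U = N" "dim_col U = N" "U * adj U = 1\<^sub>m N" "adj U * U = 1\<^sub>m N"
  using assms by (auto simp: unitary_mat_def)

text \<open>Simplification nests products to the right, so a known product \<open>A * B\<close>
  occurs only inside \<open>A * (B * X)\<close>; this rule and the next are equations in that nested
  form.\<close>

lemma mult_inverse_cancel:
  fixes A B X :: "complex mat"
  assumes "A * B = 1\<^sub>m N" "dim_col A = dim_row B" "dim_col B = dim_row X" "dim_row X = N"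
  shows "A * (B * X) = X"
  using assms by (simp flip: mat_mult_assoc_dim)

lemma mult_eq_assoc:
  fixes A B C X :: "complex mat"
  assumes "A * B = C" "dim_col A = dim_row B" "dim_col B = dim_row X"
  shows "A * (B * X) = C * X"
  using assms by (simp flip: mat_mult_assoc_dim)

lemma unitary_mat_mult:
  assumes "unitary_mat N U" "unitary_mat N V"
  shows "unitary_mat N (U * V)"
  using unitary_matD[OF assms(1)] unitary_matD[OF assms(2)]
  by (auto simp: unitary_mat_def mat_simps mult_inverse_cancel)

lemma unitary_mat_adj: "unitary_mat N U \<Longrightarrow> unitary_mat N (adj U)"
  by (auto simp: unitary_mat_def)

lemma unitary_mat_smult:
  assumes "unitary_mat N U" "cmod c = 1"
  shows "unitary_mat N (c \<cdot>\<^sub>m U)"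
proof -
  have "c * cnj c = 1" "cnj c * c = 1"
    using assms(2) complex_norm_square[of c] by (simp_all add: mult.commute)
  then show ?thesis
    using unitary_matD[OF assms(1)]
    by (simp only: unitary_mat_def mat_simps dim_adj smult_carrier_mat index_smult_mat)
qed

lemma unitary_mat_smult_imp_norm:
  assumes "unitary_mat N U" "unitary_mat N (c \<cdot>\<^sub>m U)" "N > 0"
  shows "cmod c = 1"
proof -
  have "1\<^sub>m N = (c * cnj c) \<cdot>\<^sub>m (1\<^sub>m N)"
    using unitary_matD[OF assms(1)] unitary_matD(4)[OF assms(2)] by (simp add: mat_simps mult.commute)
  then have "(1\<^sub>m N :: complex mat) $$ (0,0) = ((c * cnj c) \<cdot>\<^sub>m (1\<^sub>m N)) $$ (0,0)" by simp
  then have "c * cnj c = 1" using assms(3) by simp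
  then have "complex_of_real ((cmod c)\<^sup>2) = 1"
    by (simp only: complex_norm_square)
  then have "(cmod c)\<^sup>2 = 1"
    by (simp only: of_real_eq_1_iff)
  then show ?thesis
    by (simp add: power2_eq_1_iff) (use norm_ge_zero[of c] in linarith)
qed

text \<open>\<open>F F\<^sup>\<dagger> = 1\<close> implies \<open>F\<^sup>\<dagger> F = 1\<close> for a square matrix \<open>F\<close>, transported to arbitrary finite
  index sets.\<close>
lemma orthonormal_rows_imp_columns:
  fixes f :: "'a \<Rightarrow> 'b \<Rightarrow> complex"
  assumes fin: "finite X" "finite Y" and card: "card X = card Y"
    and rows: "\<And>x x'. x \<in> X \<Longrightarrow> x' \<in> X \<Longrightarrow>
      (\<Sum>y\<in>Y. f x y * cnj (f x' y)) = (if x = x' then 1 else 0)"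
    and y: "y \<in> Y" "y' \<in> Y"
  shows "(\<Sum>x\<in>X. f x y * cnj (f x y')) = (if y = y' then 1 else 0)"
proof -
  define k where "k = card X"
  obtain a where a: "bij_betw a {..<k} X"
    using ex_bij_betw_nat_finite[OF fin(1)] by (auto simp: k_def atLeast0LessThan)
  obtain b where b: "bij_betw b {..<k} Y"
    using ex_bij_betw_nat_finite[OF fin(2)] by (auto simp: k_def card atLeast0LessThan)
  define F where "F = mat k k (\<lambda>(i,j). f (a i) (b j))"
  have F: "F \<in> carrier_mat k k" "dim_row F = k" "dim_col F = k"
    by (auto simp: F_def)
  have aX: "a i \<in> X" if "i < k" for i
    using that a by (auto simp: bij_betw_def)
  have a_eq: "a i = a j \<longleftrightarrow> i = j" if "i < k" "j < k" for i j
    using that inj_on_eq_iff[OF bij_betw_imp_inj_on[OF a]] by simp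
  have b_eq: "b i = b j \<longleftrightarrow> i = j" if "i < k" "j < k" for i j
    using that inj_on_eq_iff[OF bij_betw_imp_inj_on[OF b]] by simp
  have "F * adj F = 1\<^sub>m k"
  proof (rule eq_matI)
    fix i j assume "i < dim_row (1\<^sub>m k :: complex mat)" "j < dim_col (1\<^sub>m k :: complex mat)"
    then have ij: "i < k" "j < k" by auto
    have "(F * adj F) $$ (i,j) = (\<Sum>l<k. f (a i) (b l) * cnj (f (a j) (b l)))"
      using ij F by (simp add: index_mult_sum del: index_mult_mat(1)) (simp add: F_def)
    also have "\<dots> = (\<Sum>y\<in>Y. f (a i) y * cnj (f (a j) y))"
      by (rule sum.reindex_bij_betw[OF b])
    also have "\<dots> = (if i = j then 1 else 0)"
      by (simp add: rows aX ij a_eq)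
    finally show "(F * adj F) $$ (i,j) = 1\<^sub>m k $$ (i,j)" using ij by simp
  qed (use F in auto)
  then have G: "adj F * F = 1\<^sub>m k"
    using F by (intro mat_mult_left_right_inverse[of F k "adj F"]) auto
  have "y \<in> b ` {..<k}" "y' \<in> b ` {..<k}"
    using b y by (auto simp: bij_betw_def)
  then obtain i j where ij: "i < k" "j < k" "b i = y" "b j = y'"
    by auto
  have "(\<Sum>x\<in>X. f x y * cnj (f x y')) = (\<Sum>l<k. f (a l) y * cnj (f (a l) y'))"
    by (rule sum.reindex_bij_betw[OF a, symmetric])
  also have "\<dots> = (adj F * F) $$ (j,i)"
    using ij F by (simp add: index_mult_sum del: index_mult_mat(1)) (simp add: F_def mult.commute)
  also have "\<dots> = (if y = y' then 1 else 0)"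
    using ij(1,2) b_eq[OF ij(1,2)] by (auto simp: G ij(3,4)[symmetric])
  finally show ?thesis .
qed

section \<open>Anticommuting families and strings\<close>

text \<open>One scalar covers commuting (1) and anticommuting (-1), so that signs simply multiply
  along products.\<close>

definition sign_commutes :: "complex \<Rightarrow> complex mat \<Rightarrow> complex mat \<Rightarrow> bool" where
  "sign_commutes s A B \<longleftrightarrow> A * B = s \<cdot>\<^sub>m (B * A)"

lemma sign_commutes_mult_right:
  assumes "A \<in> carrier_mat N N" "B \<in> carrier_mat N N" "C \<in> carrier_mat N N"
    and "sign_commutes s A B" "sign_commutes t A C"
  shows "sign_commutes (s * t) A (B * C)"
proof -
  have "A * (B * C) = A * B * C" using assms(1-3) by (simp add: mat_simps)
  also have "\<dots> = s \<cdot>\<^sub>m (B * (A * C))"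
    using assms(1-3) by (simp add: assms(4)[unfolded sign_commutes_def] mat_simps)
  also have "\<dots> = (s * t) \<cdot>\<^sub>m (B * C * A)"
    using assms(1-3) by (simp add: assms(5)[unfolded sign_commutes_def] mat_simps)
  finally show ?thesis by (simp add: sign_commutes_def)
qed

text \<open>Exchanging the two operators inverts the scalar, and \<open>s * s = 1\<close> makes it
  its own inverse.\<close>

lemma sign_commutes_sym:
  assumes "s * s = 1" "sign_commutes s A B"
  shows "sign_commutes s B A"
  using assms by (simp add: sign_commutes_def smult_smult_mat one_smult_mat)

lemma sign_commutes_adj:
  assumes "A \<in> carrier_mat N N" "B \<in> carrier_mat N N" "sign_commutes s A B"
  shows "sign_commutes (cnj s) (adj B) (adj A)"
proof -
  have "adj (A * B) = adj (s \<cdot>\<^sub>m (B * A))"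
    using assms(3) by (simp only: sign_commutes_def)
  then show ?thesis using assms(1,2) by (simp add: sign_commutes_def mat_simps)
qed

lemma sign_commutes_smult_right:
  assumes "A \<in> carrier_mat N N" "B \<in> carrier_mat N N" "sign_commutes s A B"
  shows "sign_commutes s A (c \<cdot>\<^sub>m B)"
  using assms by (auto simp: sign_commutes_def mat_simps mult.commute)

lemma sign_commutes_self: "sign_commutes 1 A A"
  by (simp add: sign_commutes_def one_smult_mat)

text \<open>Conjugation by the involution \<open>C\<close> preserves the trace but sends
  \<open>A\<close> to its negative.\<close>

lemma tr_eq_0_if_anticommutes:
  assumes "C \<in> carrier_mat N N" "A \<in> carrier_mat N N" "C * C = 1\<^sub>m N" "sign_commutes (-1) C A"
  shows "tr A = 0"
proof -
  have "tr A = tr (C * (C * A))"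
    using assms(1-3) by (simp add: mult_inverse_cancel)
  also have "\<dots> = - tr (C * (A * C))"
    using assms by (simp add: sign_commutes_def mat_simps tr_smult)
  also have "tr (C * (A * C)) = tr (A * C * C)"
    using assms(1,2) by (intro tr_mult_comm) auto
  also have "\<dots> = tr A" using assms(1-3) by (simp add: mat_simps)
  finally show ?thesis by simp
qed

text \<open>Partial products, for induction on the number of generators; the full one is a Majorana
  string without its power of i.\<close>

primrec ordered_prod :: "nat \<Rightarrow> (nat \<Rightarrow> complex mat) \<Rightarrow> (nat \<Rightarrow> bool) \<Rightarrow> nat \<Rightarrow> complex mat" where
  "ordered_prod N chi v 0 = 1\<^sub>m N"
| "ordered_prod N chi v (Suc k) =
     (if v (Suc k) then ordered_prod N chi v k * chi (Suc k) else ordered_prod N chi v k)"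

lemma ordered_prod_eq_foldl:
  "foldl (\<lambda>P i. if v i then P * chi i else P) (1\<^sub>m N) [1..<k+1] = ordered_prod N chi v k"
  by (induction k) auto

text \<open>Dimension and number of operators are independent, because the locale also has to cover
  the \<open>2 * m\<close> operators \<open>B i\<close> in dimension \<open>2 ^ n\<close>, which act
  reducibly.\<close>

locale majorana_ops =
  fixes N K :: nat and chi :: "nat \<Rightarrow> complex mat"
  assumes chi_carrier: "i \<in> {1..K} \<Longrightarrow> chi i \<in> carrier_mat N N"
    and chi_herm: "i \<in> {1..K} \<Longrightarrow> adj (chi i) = chi i"
    and chi_sq: "i \<in> {1..K} \<Longrightarrow> chi i * chi i = 1\<^sub>m N"
    and chi_anti: "i \<in> {1..K} \<Longrightarrow> k \<in> {1..K} \<Longrightarrow> i \<noteq> k \<Longrightarrow> sign_commutes (-1) (chi i) (chi k)"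
begin

lemma chi_dim: "i \<in> {1..K} \<Longrightarrow> dim_row (chi i) = N" "i \<in> {1..K} \<Longrightarrow> dim_col (chi i) = N"
  using chi_carrier by auto

lemma sign_commutes_chi_adj:
  assumes "j \<in> {1..K}" "A \<in> carrier_mat N N" "s \<in> {1,-1}" "sign_commutes s (chi j) A"
  shows "sign_commutes s (chi j) (adj A)"
proof (rule sign_commutes_sym)
  show "sign_commutes s (adj A) (chi j)"
    using sign_commutes_adj[OF chi_carrier[OF assms(1)] assms(2,4)] assms(3) chi_herm[OF assms(1)]
    by auto
qed (use assms(3) in auto)

lemma chi_unitary: "i \<in> {1..K} \<Longrightarrow> unitary_mat N (chi i)"
  using chi_carrier chi_herm chi_sq by (auto simp: unitary_mat_def)

lemma unitary_ordered_prod: "k \<le> K \<Longrightarrow> unitary_mat N (ordered_prod N chi v k)"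
proof (induction k)
  case 0
  then show ?case by (simp add: unitary_mat_def)
next
  case (Suc k)
  then show ?case by (auto intro!: unitary_mat_mult chi_unitary)
qed

lemma ordered_prod_carrier [simp]: "k \<le> K \<Longrightarrow> ordered_prod N chi v k \<in> carrier_mat N N"
  using unitary_ordered_prod unitary_matD(1) by blast

lemma sign_commutes_ordered_prod:
  assumes "A \<in> carrier_mat N N" "k \<le> K"
    and "\<And>i. i \<in> {1..k} \<Longrightarrow> v i \<Longrightarrow> sign_commutes (s i) A (chi i)"
  shows "sign_commutes (\<Prod>i\<in>{i\<in>{1..k}. v i}. s i) A (ordered_prod N chi v k)"
  using assms(2,3)
proof (induction k)
  case 0
  then show ?case using assms(1) by (simp add: sign_commutes_def one_smult_mat)
next
  case (Suc k)
  have IH: "sign_commutes (\<Prod>i\<in>{i\<in>{1..k}. v i}. s i) A (ordered_prod N chi v k)"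
    using Suc by auto
  show ?case
  proof (cases "v (Suc k)")
    case True
    then have "{i\<in>{1..Suc k}. v i} = insert (Suc k) {i\<in>{1..k}. v i}"
      by (auto simp: le_Suc_eq)
    moreover have "sign_commutes ((\<Prod>i\<in>{i\<in>{1..k}. v i}. s i) * s (Suc k)) A
        (ordered_prod N chi v k * chi (Suc k))"
      using Suc True by (intro sign_commutes_mult_right[OF assms(1) _ _ IH] chi_carrier) auto
    ultimately show ?thesis using True by (simp add: mult.commute)
  next
    case False
    then have "{i\<in>{1..Suc k}. v i} = {i\<in>{1..k}. v i}"
      by (auto simp: le_Suc_eq)
    then show ?thesis using False IH by simp
  qed
qed

text \<open>Every factor present contributes -1, except \<open>chi j\<close>, which commutes with
  itself.\<close>

lemma sign_commutes_chi_ordered_prod: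
  assumes "j \<in> {1..K}" "k \<le> K"
  shows "sign_commutes ((-1) ^ card ({i\<in>{1..k}. v i} - {j})) (chi j) (ordered_prod N chi v k)"
proof -
  have "(\<Prod>i\<in>S. if i = j then 1 else -1) = (-1 :: complex) ^ card (S - {j})"
    if "finite S" for S :: "nat set"
  proof -
    have "(\<Prod>i\<in>S. if i = j then 1 else -1) = (\<Prod>i\<in>S - {j}. -1 :: complex)"
      using that by (intro prod.mono_neutral_cong_right) auto
    then show ?thesis by simp
  qed
  then have *: "(\<Prod>i\<in>{i\<in>{1..k}. v i}. if i = j then 1 else -1)
      = (-1 :: complex) ^ card ({i\<in>{1..k}. v i} - {j})" by simp
  have "sign_commutes (if i = j then 1 else -1) (chi j) (chi i)" if "i \<in> {1..k}" for i
    using that assms chi_anti[of j i] sign_commutes_self by auto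
  then have "sign_commutes (\<Prod>i\<in>{i\<in>{1..k}. v i}. if i = j then 1 else -1) (chi j)
      (ordered_prod N chi v k)"
    by (intro sign_commutes_ordered_prod chi_carrier assms)
  then show ?thesis by (simp only: *)
qed

end

text \<open>The generators that anticommute with the product over \<open>s\<close>: those with index in \<open>s\<close>
  when \<open>s\<close> is even, those with index outside \<open>s\<close> when \<open>s\<close> is odd.\<close>
definition flip :: "nat \<Rightarrow> nat set \<Rightarrow> nat set" where
  "flip K s = (if even (card s) then s else {1..K} - s)"

lemma flip_subset: "s \<subseteq> {1..K} \<Longrightarrow> flip K s \<subseteq> {1..K}"
  by (auto simp: flip_def)

text \<open>For even \<open>K\<close> the complement of an odd set is odd. Hence
  \<open>flip K\<close> is a bijection from index sets to sign patterns: distinct strings have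
  distinct patterns, and every pattern is that of a string.\<close>

lemma flip_flip:
  assumes "s \<subseteq> {1..K}" "even K"
  shows "flip K (flip K s) = s"
proof -
  have "card ({1..K} - s) = K - card s" "card s \<le> K"
    using assms(1) card_mono[OF _ assms(1)] by (auto simp: card_Diff_subset finite_subset)
  then have "odd (card ({1..K} - s))" if "odd (card s)"
    using that assms(2) by simp
  then show ?thesis using assms(1) by (auto simp: flip_def)
qed

text \<open>Removing a member \<open>j\<close> changes the parity of the cardinality, which is why
  odd sets give the complementary pattern.\<close>

lemma odd_card_Diff_iff_flip:
  assumes "s \<subseteq> {1..K}" "j \<in> {1..K}"
  shows "odd (card (s - {j})) \<longleftrightarrow> j \<in> flip K s"
proof (cases "j \<in> s")
  case True
  then have "card s = Suc (card (s - {j}))"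
    using assms(1) by (metis card_Suc_Diff1 finite_atLeastAtMost finite_subset)
  then show ?thesis using True assms by (auto simp: flip_def)
next
  case False
  then show ?thesis using assms by (auto simp: flip_def)
qed

context majorana_ops
begin

text \<open>Indexing by sets makes the strings a finite family over \<open>Pow {1..K}\<close>, over
  which one can sum.\<close>

definition string :: "nat set \<Rightarrow> complex mat" where
  "string s = ordered_prod N chi (\<lambda>i. i \<in> s) K"

lemma unitary_string: "unitary_mat N (string s)"
  by (simp add: string_def unitary_ordered_prod)

lemma string_carrier [simp]: "string s \<in> carrier_mat N N"
  by (simp add: string_def)

lemma string_dim [simp]: "dim_row (string s) = N" "dim_col (string s) = N"
  using carrier_matD[OF string_carrier[of s]] by simp_all

lemma sign_commutes_string:
  assumes "s \<subseteq> {1..K}" "j \<in> {1..K}"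
  shows "sign_commutes (if j \<in> flip K s then -1 else 1) (chi j) (string s)"
proof -
  have *: "{i\<in>{1..K}. i \<in> s} = s" using assms(1) by auto
  have "(-1 :: complex) ^ card (s - {j}) = (if j \<in> flip K s then -1 else 1)"
    using odd_card_Diff_iff_flip[OF assms] by auto
  then show ?thesis
    using sign_commutes_chi_ordered_prod[OF assms(2), of K "\<lambda>i. i \<in> s"]
    by (simp only: string_def * order_refl)
qed

text \<open>By injectivity of \<open>flip\<close>, distinct strings have opposite signs against some
  \<open>chi j\<close>; their product then anticommutes with \<open>chi j\<close> and is
  traceless.\<close>

lemma tr_string_mult_adj_string:
  assumes "even K" "s \<subseteq> {1..K}" "s' \<subseteq> {1..K}"
  shows "tr (string s * adj (string s')) = (if s = s' then of_nat N else 0)"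
proof (cases "s = s'")
  case True
  then show ?thesis by (simp add: unitary_matD(4)[OF unitary_string])
next
  case False
  then have "flip K s \<noteq> flip K s'"
    using assms by (metis flip_flip)
  then obtain j where j': "(j \<in> flip K s) \<noteq> (j \<in> flip K s')" by auto
  then have "j \<in> {1..K}"
    using flip_subset[OF assms(2)] flip_subset[OF assms(3)] by (meson subsetD)
  note j = this j'
  have "sign_commutes (if j \<in> flip K s' then -1 else 1) (chi j) (adj (string s'))"
    using j(1) assms(3) by (intro sign_commutes_chi_adj sign_commutes_string) auto
  then have "sign_commutes (-1) (chi j) (string s * adj (string s'))"
    using j(2) sign_commutes_mult_right[OF chi_carrier[OF j(1)] string_carrier _
        sign_commutes_string[OF assms(2) j(1)], of "adj (string s')"]
    by (auto split: if_splits)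
  then show ?thesis
    using False tr_eq_0_if_anticommutes[OF chi_carrier[OF j(1)] _ chi_sq[OF j(1)]]
      mult_carrier_mat[OF string_carrier adj_carrier[OF string_carrier]] by simp
qed

end

text \<open>All scalar multiples, including the zero matrix, belong to it, so no normalisation or
  phase has to be tracked.\<close>

definition sign_centralizer :: "nat \<Rightarrow> nat \<Rightarrow> (nat \<Rightarrow> complex mat) \<Rightarrow> complex mat set" where
  "sign_centralizer N K chi = {A \<in> carrier_mat N N.
     \<forall>i\<in>{1..K}. \<exists>s\<in>{1,-1}. sign_commutes s (chi i) A}"

lemma tr_mult_adj_eq_sum:
  assumes "A \<in> carrier_mat N N" "B \<in> carrier_mat N N"
  shows "tr (A * adj B) = (\<Sum>(i,j)\<in>{..<N} \<times> {..<N}. A $$ (i,j) * cnj (B $$ (i,j)))"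
  using assms by (simp add: tr_def index_mult_sum sum.cartesian_product del: index_mult_mat(1))

section \<open>Completeness of the strings and Schur's lemma\<close>

locale irreducible_majorana = majorana_ops "2 ^ m" "2 * m" chi for m chi
begin

text \<open>The strings, suitably scaled, are orthonormal rows of a matrix whose columns are indexed
  by the pairs of matrix positions. That matrix is square of size 4^m, so its columns are
  orthonormal too.\<close>

lemma string_completeness:
  assumes "a < 2 ^ m" "b < 2 ^ m" "c < 2 ^ m" "d < 2 ^ m"
  shows "(\<Sum>s\<in>Pow {1..2*m}. string s $$ (a,b) * cnj (string s $$ (c,d)))
    = (if a = c \<and> b = d then 2 ^ m else 0)"
proof -
  \<comment> \<open>The norm of a string in the trace form.\<close>
  define r where "r = complex_of_real (sqrt (2 ^ m))"
  have r: "r * r = 2 ^ m" "cnj r = r" "r \<noteq> 0"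
    by (simp_all add: r_def flip: of_real_mult)
  define f where "f s = (\<lambda>(a,b). string s $$ (a,b) / r)" for s
  have f: "f s (a,b) * cnj (f s' (c,d)) = string s $$ (a,b) * cnj (string s' $$ (c,d)) / 2 ^ m"
    for s s' a b c d
    by (simp add: f_def r flip: r(1))
  have "(\<Sum>s\<in>Pow {1..2*m}. f s (a,b) * cnj (f s (c,d))) = (if (a,b) = (c,d) then 1 else 0)"
  proof (rule orthonormal_rows_imp_columns[where Y = "{..<2^m} \<times> {..<2^m}"])
    show "card (Pow {1..2 * m}) = card ({..<2 ^ m :: nat} \<times> {..<2 ^ m :: nat})"
      by (simp add: card_Pow card_cartesian_product flip: power_add mult_2)
  next
    fix s s' assume s: "s \<in> Pow {1..2*m}" "s' \<in> Pow {1..2*m}"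
    have "(\<Sum>y\<in>{..<2^m} \<times> {..<2^m}. f s y * cnj (f s' y))
        = tr (string s * adj (string s')) / 2 ^ m"
      by (subst tr_mult_adj_eq_sum[of _ "2^m"])
        (auto simp: sum_divide_distrib f intro!: sum.cong)
    also have "\<dots> = (if s = s' then 1 else 0)"
      using s by (simp add: tr_string_mult_adj_string)
    finally show "(\<Sum>y\<in>{..<2^m} \<times> {..<2^m}. f s y * cnj (f s' y)) = (if s = s' then 1 else 0)" .
  qed (use assms in auto)
  then show ?thesis
    by (cases "a = c \<and> b = d") (simp_all add: f flip: sum_divide_distrib)
qed

text \<open>Schur's lemma by twirling: each \<open>string s * A * adj (string s)\<close> is
  \<open>A\<close> again, while completeness evaluates the sum of these over all strings as
  \<open>2 ^ m * tr A\<close> times the identity.\<close>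

lemma commutant_scalar:
  assumes A: "A \<in> carrier_mat (2 ^ m) (2 ^ m)"
    and comm: "\<And>i. i \<in> {1..2*m} \<Longrightarrow> chi i * A = A * chi i"
  shows "A = (tr A / 2 ^ m) \<cdot>\<^sub>m 1\<^sub>m (2 ^ m)"
proof (rule eq_matI)
  fix a c assume "a < dim_row ((tr A / 2 ^ m) \<cdot>\<^sub>m 1\<^sub>m (2 ^ m))"
    "c < dim_col ((tr A / 2 ^ m) \<cdot>\<^sub>m 1\<^sub>m (2 ^ m))"
  then have ac: "a < 2 ^ m" "c < 2 ^ m" by auto
  have twirl: "string s * (A * adj (string s)) = A" for s
  proof -
    have "sign_commutes (\<Prod>i\<in>{i\<in>{1..2*m}. i \<in> s}. 1) A (string s)"
      unfolding string_def
      by (rule sign_commutes_ordered_prod) (use A comm in \<open>auto simp: sign_commutes_def one_smult_mat\<close>)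
    then have "string s * A = A * string s"
      by (simp add: sign_commutes_def one_smult_mat)
    then have "string s * A * adj (string s) = A * string s * adj (string s)"
      by simp
    then show ?thesis
      using A by (simp add: mat_mult_assoc_dim unitary_matD(4)[OF unitary_string])
  qed
  \<comment> \<open>The factor in front is the number of strings, 4^m.\<close>
  have "2 ^ m * 2 ^ m * A $$ (a,c) = (\<Sum>s\<in>Pow {1..2*m}. (string s * (A * adj (string s))) $$ (a,c))"
    by (simp add: twirl card_Pow del: index_mult_mat) (simp add: mult_2 power_add)
  also have "\<dots> = (\<Sum>s\<in>Pow {1..2*m}. \<Sum>d<2^m. \<Sum>b<2^m.
      A $$ (d,b) * (string s $$ (a,d) * cnj (string s $$ (c,b))))"
    using A ac by (intro sum.cong refl)
      (simp add: index_mult_sum sum_distrib_left del: index_mult_mat(1), simp add: ac_simps)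
  also have "\<dots> = (\<Sum>d<2^m. \<Sum>b<2^m. \<Sum>s\<in>Pow {1..2*m}.
      A $$ (d,b) * (string s $$ (a,d) * cnj (string s $$ (c,b))))"
    by (subst sum.swap) (intro sum.cong refl sum.swap)
  also have "\<dots> = (\<Sum>d<2^m. \<Sum>b<2^m. A $$ (d,b) * (if a = c \<and> d = b then 2 ^ m else 0))"
    by (intro sum.cong refl)
      (simp only: sum_distrib_left[symmetric] string_completeness ac lessThan_iff)
  also have "\<dots> = (if a = c then 2 ^ m * tr A else 0)"
    using A by (auto simp: tr_def sum_distrib_left mult.commute if_distrib cong: if_cong)
  finally show "A $$ (a,c) = ((tr A / 2 ^ m) \<cdot>\<^sub>m 1\<^sub>m (2 ^ m)) $$ (a,c)"
    using ac by (auto simp: field_simps split: if_splits)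
qed (use A in auto)

text \<open>There is a string with the same signs as \<open>A\<close> against all generators.
  Multiplying \<open>A\<close> by its adjoint cancels the signs, so the result commutes with every
  generator and is scalar.\<close>

lemma sign_centralizer_eq_strings:
  assumes "A \<in> sign_centralizer (2 ^ m) (2 * m) chi"
  obtains c s where "s \<subseteq> {1..2*m}" "A = c \<cdot>\<^sub>m string s"
proof -
  have A: "A \<in> carrier_mat (2 ^ m) (2 ^ m)" using assms by (simp add: sign_centralizer_def)
  define F where "F = {i\<in>{1..2*m}. sign_commutes (-1) (chi i) A}"
  \<comment> \<open>As \<open>flip\<close> is an involution, this is the index set whose sign
    pattern is \<open>F\<close>.\<close>
  define s where "s = flip (2 * m) F"
  have F: "F \<subseteq> {1..2*m}" by (auto simp: F_def)
  have s: "s \<subseteq> {1..2*m}" using flip_subset[OF F] by (simp add: s_def)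
  have flip_s: "flip (2 * m) s = F" by (simp add: s_def flip_flip[OF F])
  define B where "B = A * adj (string s)"
  have B: "B \<in> carrier_mat (2 ^ m) (2 ^ m)" using A by (auto simp: B_def)
  have "chi i * B = B * chi i" if i: "i \<in> {1..2*m}" for i
  proof -
    let ?e = "if i \<in> F then -1 else 1 :: complex"
    have "sign_commutes ?e (chi i) A"
      using assms i by (auto simp: F_def sign_centralizer_def)
    moreover have "sign_commutes ?e (chi i) (adj (string s))"
      using sign_commutes_chi_adj[OF i string_carrier _ sign_commutes_string[OF s i]] flip_s
      by simp
    ultimately have "sign_commutes (?e * ?e) (chi i) B"
      unfolding B_def using A by (intro sign_commutes_mult_right[OF chi_carrier[OF i]]) auto
    then show ?thesis by (simp add: sign_commutes_def one_smult_mat split: if_splits)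
  qed
  then have "B = (tr B / 2 ^ m) \<cdot>\<^sub>m 1\<^sub>m (2 ^ m)"
    by (rule commutant_scalar[OF B])
  moreover have "B * string s = A"
    using A by (simp add: B_def mat_simps unitary_matD(5)[OF unitary_string])
  ultimately have "A = (tr B / 2 ^ m) \<cdot>\<^sub>m string s"
    by (metis left_mult_one_mat string_carrier smult_mult_left_dim index_one_mat(3) string_dim(1))
  then show ?thesis using that s by blast
qed

end

section \<open>The Clifford group and its parity-preserving subgroup\<close>

lemma irreducible_majoranaI:
  assumes "majorana_family m chi"
  shows "irreducible_majorana m chi"
proof
  fix i assume i: "i \<in> {1..2 * m}"
  then show carr: "chi i \<in> carrier_mat (2 ^ m) (2 ^ m)" and "adj (chi i) = chi i"
    using assms by (auto simp: majorana_family_def)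
  have "chi i * chi i + chi i * chi i = 2 \<cdot>\<^sub>m 1\<^sub>m (2 ^ m)"
    using assms i unfolding majorana_family_def by metis
  then have *: "(chi i * chi i + chi i * chi i) $$ (a,b) = (2 \<cdot>\<^sub>m 1\<^sub>m (2 ^ m)) $$ (a,b)" for a b
    by simp
  show "chi i * chi i = 1\<^sub>m (2 ^ m)"
  proof (rule eq_matI)
    fix a b assume "a < dim_row (1\<^sub>m (2 ^ m) :: complex mat)" "b < dim_col (1\<^sub>m (2 ^ m) :: complex mat)"
    then show "(chi i * chi i) $$ (a,b) = 1\<^sub>m (2 ^ m) $$ (a,b)"
      using *[of a b] carr by (auto simp del: index_mult_mat(1) split: if_splits)
  qed (use carr in auto)
next
  fix i k assume ik: "i \<in> {1..2 * m}" "k \<in> {1..2 * m}" "i \<noteq> k"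
  then have carr: "chi i \<in> carrier_mat (2 ^ m) (2 ^ m)" "chi k \<in> carrier_mat (2 ^ m) (2 ^ m)"
    using assms by (auto simp: majorana_family_def)
  have "chi i * chi k + chi k * chi i = 0\<^sub>m (2 ^ m) (2 ^ m)"
    using assms ik unfolding majorana_family_def by metis
  then have *: "(chi i * chi k + chi k * chi i) $$ (a,b) = 0\<^sub>m (2 ^ m) (2 ^ m) $$ (a,b)" for a b
    by simp
  show "sign_commutes (- 1) (chi i) (chi k)"
    unfolding sign_commutes_def
  proof (rule eq_matI)
    fix a b assume "a < dim_row (- 1 \<cdot>\<^sub>m (chi k * chi i))" "b < dim_col (- 1 \<cdot>\<^sub>m (chi k * chi i))"
    then show "(chi i * chi k) $$ (a,b) = (- 1 \<cdot>\<^sub>m (chi k * chi i)) $$ (a,b)"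
      using *[of a b] carr by (simp add: eq_neg_iff_add_eq_0 del: index_mult_mat(1))
  qed (use carr in auto)
qed

lemma sign_centralizer_carrier: "A \<in> sign_centralizer N K chi \<Longrightarrow> A \<in> carrier_mat N N"
  by (simp add: sign_centralizer_def)

section \<open>Closure properties of the sign centralizer\<close>

context majorana_ops
begin

lemma sign_centralizer_mult:
  assumes "A \<in> sign_centralizer N K chi" "B \<in> sign_centralizer N K chi"
  shows "A * B \<in> sign_centralizer N K chi"
  unfolding sign_centralizer_def
proof (intro CollectI conjI ballI)
  show "A * B \<in> carrier_mat N N"
    using assms by (auto simp: sign_centralizer_def)
next
  fix i assume i: "i \<in> {1..K}"
  then obtain s t where st: "s \<in> {1,-1}" "sign_commutes s (chi i) A"
    "t \<in> {1,-1}" "sign_commutes t (chi i) B"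
    using assms unfolding sign_centralizer_def by blast
  have "sign_commutes (s * t) (chi i) (A * B)"
    using st assms i by (intro sign_commutes_mult_right[of _ N] chi_carrier)
      (auto simp: sign_centralizer_def)
  moreover have "s * t \<in> {1,-1}" using st by auto
  ultimately show "\<exists>s\<in>{1,-1}. sign_commutes s (chi i) (A * B)" by blast
qed

lemma sign_centralizer_smult:
  assumes "A \<in> sign_centralizer N K chi"
  shows "c \<cdot>\<^sub>m A \<in> sign_centralizer N K chi"
  unfolding sign_centralizer_def
proof (intro CollectI conjI ballI)
  show "c \<cdot>\<^sub>m A \<in> carrier_mat N N"
    using assms by (auto simp: sign_centralizer_def)
next
  fix i assume i: "i \<in> {1..K}"
  then obtain s where s: "s \<in> {1,-1}" "sign_commutes s (chi i) A"
    using assms unfolding sign_centralizer_def by blast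
  then show "\<exists>s\<in>{1,-1}. sign_commutes s (chi i) (c \<cdot>\<^sub>m A)"
    using sign_commutes_smult_right[OF chi_carrier[OF i] sign_centralizer_carrier[OF assms]] by blast
qed

lemma sign_centralizer_adj:
  assumes "A \<in> sign_centralizer N K chi"
  shows "adj A \<in> sign_centralizer N K chi"
  unfolding sign_centralizer_def
proof (intro CollectI conjI ballI)
  show "adj A \<in> carrier_mat N N"
    using sign_centralizer_carrier[OF assms] by simp
next
  fix i assume i: "i \<in> {1..K}"
  then obtain s where "s \<in> {1,-1}" "sign_commutes s (chi i) A"
    using assms unfolding sign_centralizer_def by blast
  then show "\<exists>s\<in>{1,-1}. sign_commutes s (chi i) (adj A)"
    using sign_commutes_chi_adj[OF i sign_centralizer_carrier[OF assms]] by blast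
qed

lemma chi_in_sign_centralizer: "i \<in> {1..K} \<Longrightarrow> chi i \<in> sign_centralizer N K chi"
  unfolding sign_centralizer_def using chi_carrier chi_anti sign_commutes_self
  by (auto, metis)

lemma ordered_prod_in_sign_centralizer:
  "k \<le> K \<Longrightarrow> ordered_prod N chi v k \<in> sign_centralizer N K chi"
proof (induction k)
  case 0
  then show ?case
    using chi_dim by (auto simp: sign_centralizer_def sign_commutes_def one_smult_mat)
next
  case (Suc k)
  then show ?case by (auto intro!: sign_centralizer_mult chi_in_sign_centralizer)
qed

lemma sign_centralizer_commutes_ordered_prod:
  assumes "A \<in> sign_centralizer N K chi" "k \<le> K"
  shows "\<exists>s\<in>{1,-1}. sign_commutes s A (ordered_prod N chi v k)"
proof -
  have "\<forall>i\<in>{1..K}. \<exists>s\<in>{1,-1}. sign_commutes s A (chi i)"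
  proof
    fix i assume "i \<in> {1..K}"
    then obtain s where "s \<in> {1,-1}" "sign_commutes s (chi i) A"
      using assms(1) unfolding sign_centralizer_def by blast
    moreover have "s * s = 1" using \<open>s \<in> {1,-1}\<close> by auto
    ultimately show "\<exists>s\<in>{1,-1}. sign_commutes s A (chi i)"
      using sign_commutes_sym by blast
  qed
  then have "\<forall>i\<in>{1..K}. \<exists>s. s \<in> {1,-1} \<and> sign_commutes s A (chi i)"
    by blast
  from bchoice[OF this]
  obtain s where s: "\<forall>i\<in>{1..K}. s i \<in> {1,-1} \<and> sign_commutes (s i) A (chi i)"
    by blast
  have *: "(\<Prod>i\<in>S. s i) \<in> {1,-1}" if "finite S" "S \<subseteq> {1..K}" for S
    using that
  proof (induction S rule: finite_induct)
    case (insert x S)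
    then have "s x \<in> {1,-1}" "prod s S \<in> {1,-1}" using s by auto
    then show ?case using insert by auto
  qed simp
  have "(\<Prod>i\<in>{i\<in>{1..k}. v i}. s i) \<in> {1,-1}"
    by (rule *) (use assms(2) in auto)
  moreover have "sign_commutes (\<Prod>i\<in>{i\<in>{1..k}. v i}. s i) A (ordered_prod N chi v k)"
    using s assms(2) by (intro sign_commutes_ordered_prod sign_centralizer_carrier[OF assms(1)]) auto
  ultimately show ?thesis by blast
qed

text \<open>Moving \<open>chi (Suc k)\<close> through the \<open>k\<close> earlier factors costs
  \<open>(-1) ^ k\<close>. In total the exponent counts the pairs \<open>l < i\<close>, the number
  that \<open>omegaL_form\<close> assigns to the all-ones vector.\<close>

lemma ordered_prod_all_sq:
  assumes "k \<le> K"
  shows "ordered_prod N chi (\<lambda>_. True) k * ordered_prod N chi (\<lambda>_. True) k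
    = (-1) ^ card {(i,l). i \<in> {1..k} \<and> l \<in> {1..k} \<and> l < i} \<cdot>\<^sub>m 1\<^sub>m N"
  using assms
proof (induction k)
  case 0
  then show ?case by (simp add: one_smult_mat)
next
  case (Suc k)
  let ?q = "\<lambda>k :: nat. {(i,l). i \<in> {1..k} \<and> l \<in> {1..k} \<and> l < i}"
  let ?Q = "ordered_prod N chi (\<lambda>_. True) k"
  have "?q (Suc k) = ?q k \<union> (Pair (Suc k)) ` {1..k}"
    by auto
  moreover have "finite (?q k)"
    by (rule finite_subset[of _ "{1..k} \<times> {1..k}"]) auto
  moreover have "?q k \<inter> Pair (Suc k) ` {1..k} = {}"
    by auto
  ultimately have card: "card (?q (Suc k)) = card (?q k) + k"
    using card_Un_disjoint[of "?q k" "Pair (Suc k) ` {1..k}"] by (simp add: card_image inj_on_def)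
  have chi: "chi (Suc k) \<in> carrier_mat N N" and Q: "?Q \<in> carrier_mat N N"
    using Suc by (auto intro: chi_carrier)
  have "sign_commutes ((-1) ^ card ({i\<in>{1..k}. True} - {Suc k})) (chi (Suc k)) ?Q"
    using Suc by (intro sign_commutes_chi_ordered_prod) auto
  moreover have "{i\<in>{1..k}. True} - {Suc k} = {1..k}" by auto
  ultimately have swap: "chi (Suc k) * ?Q = (-1) ^ k \<cdot>\<^sub>m (?Q * chi (Suc k))"
    by (simp only: sign_commutes_def card_atLeastAtMost diff_Suc_1)
  have "(?Q * chi (Suc k)) * (?Q * chi (Suc k)) = ?Q * (chi (Suc k) * ?Q) * chi (Suc k)"
    using chi Q by (simp add: mat_simps)
  also have "\<dots> = (-1) ^ k \<cdot>\<^sub>m (?Q * ?Q * (chi (Suc k) * chi (Suc k)))"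
    using chi Q unfolding swap by (simp add: mat_simps)
  also have "chi (Suc k) * chi (Suc k) = 1\<^sub>m N"
    using Suc by (intro chi_sq) auto
  also have "(-1) ^ k \<cdot>\<^sub>m (?Q * ?Q * 1\<^sub>m N) = (-1) ^ k \<cdot>\<^sub>m (?Q * ?Q)"
    using Q by simp
  also have "\<dots> = (-1) ^ (card (?q (Suc k))) \<cdot>\<^sub>m 1\<^sub>m N"
    using Suc by (simp only: card) (simp add: smult_smult_mat power_add mult.commute)
  finally show ?case by simp
qed

end

section \<open>Clifford operators as stabilizers of the sign centralizer\<close>

context irreducible_majorana
begin

abbreviation SC where "SC \<equiv> sign_centralizer (2 ^ m) (2 * m) chi"

lemma majorana_string_eq:
  "majorana_string m chi v = \<i> ^ omegaL_form m v \<cdot>\<^sub>m ordered_prod (2 ^ m) chi v (2 * m)"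
  using ordered_prod_eq_foldl[of v chi "2 ^ m" "2 * m"] by (simp add: majorana_string_def)

lemma majorana_string_in_SC: "majorana_string m chi v \<in> SC"
  unfolding majorana_string_eq by (intro sign_centralizer_smult ordered_prod_in_sign_centralizer) simp

lemma SC_eq_smult_majorana_string:
  assumes "A \<in> SC"
  obtains c v where "A = c \<cdot>\<^sub>m majorana_string m chi v"
proof -
  obtain c s where "A = c \<cdot>\<^sub>m string s"
    using sign_centralizer_eq_strings[OF assms] .
  then have "A = (c / \<i> ^ omegaL_form m (\<lambda>i. i \<in> s)) \<cdot>\<^sub>m majorana_string m chi (\<lambda>i. i \<in> s)"
    by (simp add: majorana_string_eq string_def smult_smult_mat)
  then show ?thesis using that by blast
qed

text \<open>\<open>B\<close> is a multiple of a product of generators, and \<open>A\<close> commutes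
  up to sign with each of them.\<close>

lemma SC_sign_commute:
  assumes "A \<in> SC" "B \<in> SC"
  obtains s where "s \<in> {1,-1}" "sign_commutes s A B"
proof -
  obtain c S where B: "B = c \<cdot>\<^sub>m string S"
    using sign_centralizer_eq_strings[OF assms(2)] .
  obtain s where "s \<in> {1,-1}" "sign_commutes s A (string S)"
    using sign_centralizer_commutes_ordered_prod[OF assms(1) order_refl, of "\<lambda>i. i \<in> S"]
    unfolding string_def by blast
  then show ?thesis
    using that sign_commutes_smult_right[OF sign_centralizer_carrier[OF assms(1)] string_carrier] B
    by blast
qed

lemma clifford_unitary: "g \<in> majorana_clifford m chi \<Longrightarrow> unitary_mat (2 ^ m) g"
  by (simp add: majorana_clifford_def)

text \<open>Elements of \<open>SC\<close> are the multiples of Majorana strings, so being Clifford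
  amounts to stability of \<open>SC\<close> under conjugation; \<open>cliffordI\<close> is the
  converse.\<close>

lemma clifford_conj_SC:
  assumes g: "g \<in> majorana_clifford m chi" and A: "A \<in> SC"
  shows "g * A * adj g \<in> SC"
proof -
  obtain c v where v: "A = c \<cdot>\<^sub>m majorana_string m chi v"
    using SC_eq_smult_majorana_string[OF A] .
  obtain d w where "g * majorana_string m chi v * adj g = d \<cdot>\<^sub>m majorana_string m chi w"
    using g by (auto simp: majorana_clifford_def)
  moreover have "g * A * adj g = c \<cdot>\<^sub>m (g * majorana_string m chi v * adj g)"
    using unitary_matD[OF clifford_unitary[OF g]]
      sign_centralizer_carrier[OF majorana_string_in_SC, of v]
    by (simp add: v mat_simps)
  ultimately show ?thesis
    by (simp add: sign_centralizer_smult majorana_string_in_SC)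
qed

lemma cliffordI:
  assumes g: "unitary_mat (2 ^ m) g" and "\<And>A. A \<in> SC \<Longrightarrow> g * A * adj g \<in> SC"
  shows "g \<in> majorana_clifford m chi"
proof -
  have "\<exists>c w. g * majorana_string m chi v * adj g = c \<cdot>\<^sub>m majorana_string m chi w" for v
    using SC_eq_smult_majorana_string[OF assms(2)[OF majorana_string_in_SC]] by metis
  then obtain c w where "\<And>v. g * majorana_string m chi v * adj g = c v \<cdot>\<^sub>m majorana_string m chi (w v)"
    by metis
  then show ?thesis using g unfolding majorana_clifford_def by blast
qed

text \<open>The sign of \<open>chi i\<close> against \<open>g * A * adj g\<close> is the sign of
  \<open>adj g * chi i * g\<close> against \<open>A\<close>, and any two elements of
  \<open>SC\<close> have such a sign. Because the test concerns the inverse conjugation, closure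
  under \<open>adj\<close> follows at once.\<close>

lemma cliffordI_generators:
  assumes g: "unitary_mat (2 ^ m) g"
    and gen: "\<And>i. i \<in> {1..2*m} \<Longrightarrow> adj g * chi i * g \<in> SC"
  shows "g \<in> majorana_clifford m chi"
proof (rule cliffordI[OF g])
  note gD = unitary_matD[OF g]
  fix A assume A: "A \<in> SC"
  note Ac = sign_centralizer_carrier[OF A]
  show "g * A * adj g \<in> SC"
    unfolding sign_centralizer_def
  proof (intro CollectI conjI ballI)
    show "g * A * adj g \<in> carrier_mat (2 ^ m) (2 ^ m)" using gD(1) Ac by auto
  next
    fix i assume i: "i \<in> {1..2*m}"
    let ?C = "adj g * chi i * g"
    obtain s where s: "s \<in> {1,-1}" "sign_commutes s ?C A"
      using SC_sign_commute[OF gen[OF i] A] .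
    have "chi i * (g * A * adj g) = g * (?C * A) * adj g"
      using gD Ac chi_dim[OF i] by (simp add: mat_simps mult_inverse_cancel)
    also have "\<dots> = s \<cdot>\<^sub>m (g * (A * ?C) * adj g)"
      using gD Ac chi_dim[OF i] unfolding s(2)[unfolded sign_commutes_def] by (simp add: mat_simps)
    also have "g * (A * ?C) * adj g = g * A * adj g * chi i"
      using gD Ac chi_dim[OF i] by (simp add: mat_simps mult_inverse_cancel)
    finally show "\<exists>s\<in>{1,-1}. sign_commutes s (chi i) (g * A * adj g)"
      using s(1) by (auto simp: sign_commutes_def)
  qed
qed

lemma clifford_adj:
  assumes "g \<in> majorana_clifford m chi"
  shows "adj g \<in> majorana_clifford m chi"
proof (rule cliffordI_generators)
  show "unitary_mat (2 ^ m) (adj g)"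
    using assms by (intro unitary_mat_adj clifford_unitary)
  show "adj (adj g) * chi i * adj g \<in> SC" if "i \<in> {1..2*m}" for i
    unfolding adj_adj using that assms by (intro clifford_conj_SC chi_in_sign_centralizer)
qed

lemma clifford_mult:
  assumes g: "g \<in> majorana_clifford m chi" and h: "h \<in> majorana_clifford m chi"
  shows "g * h \<in> majorana_clifford m chi"
proof (rule cliffordI)
  note D = unitary_matD[OF clifford_unitary[OF g]] unitary_matD[OF clifford_unitary[OF h]]
  fix A assume A: "A \<in> SC"
  have "g * h * A * adj (g * h) = g * (h * A * adj h) * adj g"
    using D sign_centralizer_carrier[OF A] by (simp add: mat_simps)
  then show "g * h * A * adj (g * h) \<in> SC"
    using A g h by (simp add: clifford_conj_SC)
qed (use g h in \<open>auto intro: unitary_mat_mult clifford_unitary\<close>)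

lemma clifford_smult:
  assumes g: "g \<in> majorana_clifford m chi" and c: "cmod c = 1"
  shows "c \<cdot>\<^sub>m g \<in> majorana_clifford m chi"
proof (rule cliffordI)
  note D = unitary_matD[OF clifford_unitary[OF g]]
  fix A assume A: "A \<in> SC"
  have "(c \<cdot>\<^sub>m g) * A * adj (c \<cdot>\<^sub>m g) = (c * cnj c) \<cdot>\<^sub>m (g * A * adj g)"
    using D sign_centralizer_carrier[OF A] by (simp add: mat_simps mult.commute)
  then show "(c \<cdot>\<^sub>m g) * A * adj (c \<cdot>\<^sub>m g) \<in> SC"
    using A g by (simp add: clifford_conj_SC sign_centralizer_smult)
qed (use g c in \<open>auto intro: unitary_mat_smult clifford_unitary\<close>)

text \<open>There are finitely many strings, and for each one the entry (0,0) of
  \<open>A * A = 1\<close> already leaves at most two scalars.\<close>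

lemma finite_SC_involutions: "finite {A \<in> SC. A * A = 1\<^sub>m (2 ^ m)}"
proof (rule finite_subset)
  let ?T = "\<lambda>s. {c. c\<^sup>2 * (string s * string s) $$ (0,0) = 1}"
  show "{A \<in> SC. A * A = 1\<^sub>m (2 ^ m)} \<subseteq> (\<Union>s\<in>Pow {1..2*m}. (\<lambda>c. c \<cdot>\<^sub>m string s) ` ?T s)"
  proof
    fix A assume "A \<in> {A \<in> SC. A * A = 1\<^sub>m (2 ^ m)}"
    then have A: "A \<in> SC" "A * A = 1\<^sub>m (2 ^ m)" by auto
    obtain c s where cs: "s \<subseteq> {1..2*m}" "A = c \<cdot>\<^sub>m string s"
      using sign_centralizer_eq_strings[OF A(1)] .
    have "A * A = (c * c) \<cdot>\<^sub>m (string s * string s)"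
      by (simp add: cs(2) mat_simps)
    then have "1\<^sub>m (2 ^ m) $$ (0,0) = ((c * c) \<cdot>\<^sub>m (string s * string s)) $$ (0,0)"
      by (simp only: A(2))
    then have "c \<in> ?T s" by (simp add: power2_eq_square del: index_mult_mat(1))
    then show "A \<in> (\<Union>s\<in>Pow {1..2*m}. (\<lambda>c. c \<cdot>\<^sub>m string s) ` ?T s)"
      using cs by auto
  qed
  have "finite {c. c\<^sup>2 * x = 1}" for x :: complex
  proof (cases "x = 0")
    case False
    then have "c\<^sup>2 = (csqrt (1 / x))\<^sup>2" if "c\<^sup>2 * x = 1" for c
      using that by (simp add: field_simps)
    then have "{c. c\<^sup>2 * x = 1} \<subseteq> {csqrt (1 / x), - csqrt (1 / x)}"
      unfolding power2_eq_iff by blast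
    then show ?thesis by (rule finite_subset) simp
  qed simp
  then show "finite (\<Union>s\<in>Pow {1..2*m}. (\<lambda>c. c \<cdot>\<^sub>m string s) ` ?T s)" by auto
qed

text \<open>\<open>adj h * g\<close> commutes with all generators, hence is scalar by Schur's lemma;
  unitarity makes the scalar a phase.\<close>

lemma commuting_unitary_eq_smult:
  assumes g: "unitary_mat (2 ^ m) g" and h: "unitary_mat (2 ^ m) h"
    and eq: "\<And>i. i \<in> {1..2*m} \<Longrightarrow> g * chi i * adj g = h * chi i * adj h"
  obtains c where "cmod c = 1" "g = c \<cdot>\<^sub>m h"
proof -
  note D = unitary_matD[OF g] unitary_matD[OF h]
  have "chi i * (adj h * g) = adj h * g * chi i" if i: "i \<in> {1..2*m}" for i
  proof -
    have "adj h * (h * chi i * adj h) * g = adj h * (g * chi i * adj g) * g"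
      by (simp add: eq[OF i])
    then show ?thesis
      using D chi_dim[OF i] by (simp add: mat_simps mult_inverse_cancel)
  qed
  moreover have "adj h * g \<in> carrier_mat (2 ^ m) (2 ^ m)" using D by auto
  moreover define c where "c = tr (adj h * g) / 2 ^ m"
  ultimately have "adj h * g = c \<cdot>\<^sub>m 1\<^sub>m (2 ^ m)"
    unfolding c_def by (intro commutant_scalar)
  then have "h * (adj h * g) = h * (c \<cdot>\<^sub>m 1\<^sub>m (2 ^ m))" by simp
  then have gc: "g = c \<cdot>\<^sub>m h" using D by (simp add: mat_simps mult_inverse_cancel)
  then have "cmod c = 1"
    using unitary_mat_smult_imp_norm[OF h, of c] g by simp
  then show ?thesis using that gc by blast
qed

end

section \<open>Finiteness of the Clifford group modulo phases\<close>

lemma phase_class_smult: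
  assumes "cmod c = 1"
  shows "{d \<cdot>\<^sub>m (c \<cdot>\<^sub>m U) | d. cmod d = 1} = {d \<cdot>\<^sub>m U | d. cmod d = 1}"
proof -
  have c: "c \<noteq> 0" using assms by auto
  have "\<exists>e. d \<cdot>\<^sub>m (c \<cdot>\<^sub>m U) = e \<cdot>\<^sub>m U \<and> cmod e = 1" if "cmod d = 1" for d
    using assms that by (intro exI[of _ "d * c"]) (simp add: smult_smult_mat norm_mult)
  moreover have "\<exists>e. d \<cdot>\<^sub>m U = e \<cdot>\<^sub>m (c \<cdot>\<^sub>m U) \<and> cmod e = 1" if "cmod d = 1" for d
    using assms that c by (intro exI[of _ "d / c"]) (simp add: smult_smult_mat norm_divide)
  ultimately show ?thesis by blast
qed

lemma finite_image_if_determined: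
  assumes "finite (f ` A)" "\<And>x y. x \<in> A \<Longrightarrow> y \<in> A \<Longrightarrow> f x = f y \<Longrightarrow> g x = g y"
  shows "finite (g ` A)"
proof (rule finite_subset)
  show "g ` A \<subseteq> (\<lambda>z. g (SOME x. x \<in> A \<and> f x = z)) ` f ` A"
  proof
    fix w assume "w \<in> g ` A"
    then obtain x where x: "x \<in> A" "w = g x" by auto
    then have "(SOME y. y \<in> A \<and> f y = f x) \<in> A \<and> f (SOME y. y \<in> A \<and> f y = f x) = f x"
      by (intro someI_ex[where P = "\<lambda>y. y \<in> A \<and> f y = f x"]) auto
    then have "w = g (SOME y. y \<in> A \<and> f y = f x)"
      using x assms(2) by metis
    then show "w \<in> (\<lambda>z. g (SOME x. x \<in> A \<and> f x = z)) ` f ` A" using x by blast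
  qed
  show "finite ((\<lambda>z. g (SOME x. x \<in> A \<and> f x = z)) ` f ` A)" using assms(1) by simp
qed

context irreducible_majorana
begin

text \<open>A class is determined by the conjugates of the generators, and these are involutions in
  the finite set of \<open>finite_SC_involutions\<close>.\<close>

lemma finite_phase_classes_clifford: "finite (phase_classes (majorana_clifford m chi))"
  unfolding phase_classes_def
proof (rule finite_image_if_determined)
  let ?f = "\<lambda>g. \<lambda>i\<in>{1..2*m}. g * chi i * adj g"
  show "finite (?f ` majorana_clifford m chi)"
  proof (rule finite_subset)
    show "finite (Pi\<^sub>E {1..2*m} (\<lambda>_. {A \<in> SC. A * A = 1\<^sub>m (2 ^ m)}))"
      by (intro finite_PiE finite_SC_involutions) simp
    show "?f ` majorana_clifford m chi \<subseteq> Pi\<^sub>E {1..2*m} (\<lambda>_. {A \<in> SC. A * A = 1\<^sub>m (2 ^ m)})"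
    proof (intro image_subsetI restrict_PiE_iff[THEN iffD2] ballI CollectI conjI)
      fix g i assume g: "g \<in> majorana_clifford m chi" and i: "i \<in> {1..2*m}"
      show "g * chi i * adj g \<in> SC"
        using g i by (intro clifford_conj_SC chi_in_sign_centralizer)
      show "g * chi i * adj g * (g * chi i * adj g) = 1\<^sub>m (2 ^ m)"
        using unitary_matD[OF clifford_unitary[OF g]] chi_dim[OF i] chi_sq[OF i]
        by (simp add: mat_simps mult_inverse_cancel)
    qed
  qed
next
  fix g h assume g: "g \<in> majorana_clifford m chi" and h: "h \<in> majorana_clifford m chi"
    and eq: "(\<lambda>i\<in>{1..2*m}. g * chi i * adj g) = (\<lambda>i\<in>{1..2*m}. h * chi i * adj h)"
  have "g * chi i * adj g = h * chi i * adj h" if "i \<in> {1..2*m}" for i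
    using fun_cong[OF eq, of i] that by simp
  then obtain c where "cmod c = 1" "g = c \<cdot>\<^sub>m h"
    using commuting_unitary_eq_smult[OF clifford_unitary[OF g] clifford_unitary[OF h]] by blast
  then show "{c \<cdot>\<^sub>m g | c. cmod c = 1} = {c \<cdot>\<^sub>m h | c. cmod c = 1}"
    by (simp only: phase_class_smult)
qed

section \<open>The parity operator and the p-Clifford group\<close>

definition parity :: "complex mat" where
  "parity = majorana_string m chi all_ones"

lemma parity_SC: "parity \<in> SC"
  by (simp add: parity_def majorana_string_in_SC)

lemma parity_carrier [simp]: "parity \<in> carrier_mat (2 ^ m) (2 ^ m)"
  by (rule sign_centralizer_carrier[OF parity_SC])

lemma parity_dim [simp]: "dim_row parity = 2 ^ m" "dim_col parity = 2 ^ m"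
  using carrier_matD[OF parity_carrier] by simp_all

text \<open>The square of the power of i is the same sign as the square of the ordered product, so
  the two cancel.\<close>

lemma parity_sq: "parity * parity = 1\<^sub>m (2 ^ m)"
proof -
  let ?Q = "ordered_prod (2 ^ m) chi (\<lambda>_. True) (2 * m)"
  let ?k = "omegaL_form m all_ones"
  have Q: "?Q \<in> carrier_mat (2 ^ m) (2 ^ m)" by simp
  have "?Q * ?Q = (-1) ^ ?k \<cdot>\<^sub>m 1\<^sub>m (2 ^ m)"
    using ordered_prod_all_sq[OF order_refl] by (simp only: omegaL_form_def all_ones_def simp_thms)
  moreover have "parity * parity = (\<i> ^ ?k * \<i> ^ ?k) \<cdot>\<^sub>m (?Q * ?Q)"
    using carrier_matD[OF Q] by (simp add: parity_def majorana_string_eq all_ones_def mat_simps)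
  moreover have "(\<i> ^ ?k * \<i> ^ ?k) * (-1) ^ ?k = 1"
    by (simp flip: power_mult_distrib)
  ultimately show ?thesis by (simp add: smult_smult_mat one_smult_mat)
qed

lemma parity_unitary: "unitary_mat (2 ^ m) parity"
  unfolding parity_def majorana_string_eq
  by (intro unitary_mat_smult unitary_ordered_prod) (auto simp: norm_power)

lemma parity_herm: "adj parity = parity"
proof -
  have "adj parity = adj parity * (parity * parity)" by (simp add: parity_sq)
  also have "\<dots> = parity"
    by (simp only: mult_inverse_cancel[OF unitary_matD(5)[OF parity_unitary]] dim_adj parity_dim)
  finally show ?thesis .
qed

text \<open>\<open>chi i\<close> passes the \<open>2 * m - 1\<close> other factors, an odd
  number.\<close>

lemma parity_anticommutes_chi: "i \<in> {1..2*m} \<Longrightarrow> sign_commutes (-1) (chi i) parity"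
proof -
  assume i: "i \<in> {1..2*m}"
  have "{j\<in>{1..2*m}. True} - {i} = {1..2*m} - {i}" by auto
  moreover have "odd (card ({1..2*m} - {i}))" using i by (subst card_Diff_singleton) auto
  ultimately have "sign_commutes (-1) (chi i) (ordered_prod (2 ^ m) chi (\<lambda>_. True) (2 * m))"
    using sign_commutes_chi_ordered_prod[OF i order_refl, of "\<lambda>_. True"] by simp
  then show ?thesis
    unfolding parity_def majorana_string_eq all_ones_def
    by (intro sign_commutes_smult_right[OF chi_carrier[OF i]]) auto
qed

lemma tr_parity: "m \<ge> 1 \<Longrightarrow> tr parity = 0"
  using tr_eq_0_if_anticommutes[OF chi_carrier parity_carrier chi_sq parity_anticommutes_chi, of 1]
  by simp

lemma p_clifford_eq: "p_clifford m chi = {g \<in> majorana_clifford m chi. g * parity = parity * g}"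
  by (simp add: p_clifford_def parity_def)

lemma p_clifford_mult:
  assumes g: "g \<in> p_clifford m chi" and h: "h \<in> p_clifford m chi"
  shows "g * h \<in> p_clifford m chi"
proof -
  have "g \<in> majorana_clifford m chi" "h \<in> majorana_clifford m chi"
    and comm: "g * parity = parity * g" "h * parity = parity * h"
    using g h by (auto simp: p_clifford_eq)
  note D = unitary_matD[OF clifford_unitary[OF this(1)]] unitary_matD[OF clifford_unitary[OF this(2)]]
  have "g * h * parity = g * (h * parity)" using D by (simp add: mat_simps)
  also have "\<dots> = g * parity * h" using D by (simp add: mat_simps comm(2))
  also have "\<dots> = parity * (g * h)" using D unfolding comm(1) by (simp add: mat_simps)
  finally have "g * h * parity = parity * (g * h)" .
  then show ?thesis using g h by (simp add: p_clifford_eq clifford_mult)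
qed

lemma p_clifford_adj:
  assumes g: "g \<in> p_clifford m chi"
  shows "adj g \<in> p_clifford m chi"
proof -
  have *: "g \<in> majorana_clifford m chi" "g * parity = parity * g"
    using g by (auto simp: p_clifford_eq)
  note D = unitary_matD[OF clifford_unitary[OF *(1)]]
  have "adj (g * parity) = adj (parity * g)" using * by simp
  then have "adj g * parity = parity * adj g"
    using D by (simp add: mat_simps parity_herm)
  then show ?thesis using * by (simp add: p_clifford_eq clifford_adj)
qed

lemma p_clifford_smult:
  assumes g: "g \<in> p_clifford m chi" and c: "cmod c = 1"
  shows "c \<cdot>\<^sub>m g \<in> p_clifford m chi"
proof -
  have *: "g \<in> majorana_clifford m chi" "g * parity = parity * g"
    using g by (auto simp: p_clifford_eq)
  then show ?thesis
    using unitary_matD[OF clifford_unitary[OF *(1)]] c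
    by (simp add: p_clifford_eq clifford_smult mat_simps)
qed

lemma finite_phase_classes_p_clifford: "finite (phase_classes (p_clifford m chi))"
  using finite_phase_classes_clifford
  by (rule finite_subset[rotated]) (auto simp: phase_classes_def p_clifford_def)

end

section \<open>The even-parity sector\<close>

locale parity_reduction = big: irreducible_majorana n chi + small: irreducible_majorana m chi'
  for n m chi chi' + assumes n_eq: "n = Suc m"
begin

lemma index_simps:
  "2 * n \<in> {1..2*n}" "Suc (2 * m) \<in> {1..2*n}" "Suc (2 * m) \<noteq> 2 * n" "2 * n \<noteq> Suc (2 * m)"
  "i \<in> {1..2*m} \<Longrightarrow> i \<in> {1..2*n}"
  "i \<in> {1..2*m} \<Longrightarrow> i \<noteq> 2 * n" "i \<in> {1..2*m} \<Longrightarrow> 2 * n \<noteq> i"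
  "i \<in> {1..2*m} \<Longrightarrow> i \<noteq> Suc (2 * m)" "i \<in> {1..2*m} \<Longrightarrow> Suc (2 * m) \<noteq> i"
  by (auto simp: n_eq)

abbreviation "last_chi \<equiv> chi (2 * n)"
text \<open>The index is \<open>2 * n - 1\<close>, the one just before the last; no
  \<open>B i\<close> contains this generator.\<close>

abbreviation "kappa \<equiv> chi (Suc (2 * m))"

text \<open>An even operator, so it preserves both parity sectors. The factor i restores
  Hermiticity, since \<open>chi i\<close> and \<open>last_chi\<close> anticommute.\<close>

definition B :: "nat \<Rightarrow> complex mat" where
  "B i = \<i> \<cdot>\<^sub>m (chi i * last_chi)"

definition proj :: "complex mat" where
  "proj = (1/2) \<cdot>\<^sub>m (1\<^sub>m (2 ^ n) + big.parity)"

lemma chi_simps: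
  "dim_row last_chi = 2 ^ n" "dim_col last_chi = 2 ^ n"
  "dim_row kappa = 2 ^ n" "dim_col kappa = 2 ^ n"
  "last_chi * last_chi = 1\<^sub>m (2 ^ n)" "kappa * kappa = 1\<^sub>m (2 ^ n)"
  "adj kappa = kappa" "adj last_chi = last_chi"
  by (intro big.chi_dim big.chi_sq big.chi_herm index_simps)+

lemma chi_dim_small: "i \<in> {1..2*m} \<Longrightarrow> dim_row (chi i) = 2 ^ n"
  "i \<in> {1..2*m} \<Longrightarrow> dim_col (chi i) = 2 ^ n"
  by (intro big.chi_dim index_simps; assumption)+

lemma B_carrier: "i \<in> {1..2*m} \<Longrightarrow> B i \<in> carrier_mat (2 ^ n) (2 ^ n)"
  using chi_dim_small[of i] chi_simps by (auto simp: B_def)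

lemma last_chi_swap:
  assumes "i \<in> {1..2*m}"
  shows "last_chi * chi i = (-1) \<cdot>\<^sub>m (chi i * last_chi)"
  using big.chi_anti[OF index_simps(1,5,7)] assms by (simp add: sign_commutes_def)

text \<open>The square of i cancels the sign from moving \<open>last_chi\<close> past
  \<open>chi k\<close>. Thus the \<open>B i\<close> inherit squares and anticommutation from the
  \<open>chi i\<close>.\<close>

lemma B_mult:
  assumes i: "i \<in> {1..2*m}" and k: "k \<in> {1..2*m}"
  shows "B i * B k = chi i * chi k"
proof -
  have "B i * B k = (-1) \<cdot>\<^sub>m (chi i * ((last_chi * chi k) * last_chi))"
    using chi_dim_small[OF i] chi_dim_small[OF k] chi_simps by (simp add: B_def mat_simps)
  also have "(last_chi * chi k) * last_chi = (-1) \<cdot>\<^sub>m chi k"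
    using last_chi_swap[OF k] chi_dim_small[OF k] chi_simps by (simp add: mat_simps)
  finally show ?thesis
    using chi_dim_small[OF i] chi_dim_small[OF k] by (simp add: mat_simps)
qed

sublocale B: majorana_ops "2 ^ n" "2 * m" B
proof
  fix i assume i: "i \<in> {1..2*m}"
  then show "B i \<in> carrier_mat (2 ^ n) (2 ^ n)" by (rule B_carrier)
  show "adj (B i) = B i"
    using last_chi_swap[OF i] big.chi_herm[OF index_simps(5)[OF i]] chi_dim_small[OF i] chi_simps
    by (simp add: B_def mat_simps)
  show "B i * B i = 1\<^sub>m (2 ^ n)"
    using B_mult[OF i i] big.chi_sq[OF index_simps(5)[OF i]] by simp
next
  fix i k assume "i \<in> {1..2*m}" "k \<in> {1..2*m}" "i \<noteq> k"
  then show "sign_commutes (- 1) (B i) (B k)"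
    using B_mult[of i k] B_mult[of k i] big.chi_anti[OF index_simps(5,5), of i k]
    by (simp add: sign_commutes_def)
qed

lemma B_in_SC: "i \<in> {1..2*m} \<Longrightarrow> B i \<in> big.SC"
  unfolding B_def
  by (intro big.sign_centralizer_smult big.sign_centralizer_mult big.chi_in_sign_centralizer
      index_simps)

lemma sign_commutes_chi_B:
  assumes "A \<in> carrier_mat (2 ^ n) (2 ^ n)" "i \<in> {1..2*m}"
    "sign_commutes s A (chi i)" "sign_commutes t A last_chi"
  shows "sign_commutes (s * t) A (B i)"
proof -
  have c: "chi i \<in> carrier_mat (2 ^ n) (2 ^ n)" "last_chi \<in> carrier_mat (2 ^ n) (2 ^ n)"
    by (intro big.chi_carrier index_simps assms)+
  show ?thesis unfolding B_def
    by (intro sign_commutes_smult_right[OF assms(1)] sign_commutes_mult_right[OF assms(1)] c assms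
        mult_carrier_mat[OF c])
qed

lemma parity_commutes_B:
  assumes i: "i \<in> {1..2*m}"
  shows "big.parity * B i = B i * big.parity"
proof -
  have *: "sign_commutes (-1) big.parity (chi j)" if "j \<in> {1..2 * n}" for j
    using big.parity_anticommutes_chi[OF that] sign_commutes_sym[of "-1"] by simp
  then have "sign_commutes ((-1) * (-1)) big.parity (B i)"
    by (intro sign_commutes_chi_B i big.parity_carrier * index_simps)
  then show ?thesis by (simp add: sign_commutes_def one_smult_mat)
qed

text \<open>\<open>kappa\<close> anticommutes with both factors of \<open>B i\<close>, and the two
  signs cancel.\<close>

lemma kappa_commutes_B:
  assumes i: "i \<in> {1..2*m}"
  shows "kappa * B i = B i * kappa"
proof -
  have "sign_commutes ((-1) * (-1)) kappa (B i)"
    by (intro sign_commutes_chi_B big.chi_anti big.chi_carrier index_simps i)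
  then show ?thesis by (simp add: sign_commutes_def one_smult_mat)
qed

lemma kappa_parity: "kappa * big.parity = (-1) \<cdot>\<^sub>m (big.parity * kappa)"
  using big.parity_anticommutes_chi[OF index_simps(2)] by (simp add: sign_commutes_def)

section \<open>The projection onto the even sector\<close>

lemma proj_carrier [simp]: "proj \<in> carrier_mat (2 ^ n) (2 ^ n)"
  by (auto simp: proj_def)

lemma proj_dim [simp]: "dim_row proj = 2 ^ n" "dim_col proj = 2 ^ n"
  using carrier_matD[OF proj_carrier] by simp_all

lemma proj_herm: "adj proj = proj"
  by (simp add: proj_def adj_smult adj_add big.parity_herm)

lemma parity_proj: "big.parity * proj = proj"
proof -
  have "big.parity * proj = (1/2) \<cdot>\<^sub>m (big.parity + 1\<^sub>m (2 ^ n))"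
    by (simp add: proj_def mat_simps mult_add_dim big.parity_sq)
  also have "\<dots> = proj" unfolding proj_def by (rule eq_matI) (auto simp: add.commute)
  finally show ?thesis .
qed

lemma proj_eq_if_parity_eq:
  assumes "dim_row X = 2 ^ n" "big.parity * X = X"
  shows "proj * X = X"
proof -
  have "proj * X = (1/2) \<cdot>\<^sub>m (X + X)"
    using assms by (simp add: proj_def mat_simps add_mult_dim)
  also have "\<dots> = X" by (rule eq_matI) auto
  finally show ?thesis .
qed

text \<open>The parity is traceless, so half of the dimension \<open>2 ^ n\<close> is left: exactly
  the dimension of the small space.\<close>

lemma tr_proj: "tr proj = 2 ^ m"
  using big.tr_parity by (simp add: proj_def tr_smult tr_add[of _ "2 ^ n"]) (simp add: n_eq)

text \<open>As \<open>kappa\<close> anticommutes with the parity, conjugation by it turns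
  \<open>proj\<close> into the projection onto the odd sector.\<close>

lemma proj_plus_kappa_proj_kappa: "proj + kappa * (proj * kappa) = 1\<^sub>m (2 ^ n)"
proof -
  have "kappa * (big.parity * kappa) = (kappa * big.parity) * kappa"
    using chi_simps by (simp add: mat_simps)
  also have "\<dots> = (-1) \<cdot>\<^sub>m big.parity"
    unfolding kappa_parity using chi_simps by (simp add: mat_simps)
  finally have "kappa * (proj * kappa) = (1/2) \<cdot>\<^sub>m (1\<^sub>m (2 ^ n) + (-1) \<cdot>\<^sub>m big.parity)"
    using chi_simps by (simp add: proj_def mat_simps add_mult_dim mult_add_dim)
  then show ?thesis
    by (intro eq_matI) (auto simp: proj_def field_simps)
qed

lemma commutes_proj:
  assumes "A \<in> carrier_mat (2 ^ n) (2 ^ n)" "A * big.parity = big.parity * A"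
  shows "A * proj = proj * A"
  using assms by (simp add: proj_def mat_simps add_mult_dim mult_add_dim)

text \<open>Symmetrizing \<open>X\<close> under \<open>X \<mapsto> B\<^sub>i X \<chi>'\<^sub>i\<close> one index at a time. If the symmetrization vanishes
  then \<open>X\<close> is antisymmetric, and it is kept; the resulting signs are removed afterwards by a string.\<close>
lemma signed_intertwiner:
  assumes "k \<le> 2 * m"
  shows "\<exists>X\<in>carrier_mat (2 ^ n) (2 ^ m). X \<noteq> 0\<^sub>m (2 ^ n) (2 ^ m) \<and> big.parity * X = X \<and>
    (\<forall>i\<in>{1..k}. \<exists>e\<in>{1,-1}. B i * X * chi' i = e \<cdot>\<^sub>m X)"
  using assms
proof (induction k)
  case 0
  have "\<exists>a<2 ^ n. proj $$ (a,a) \<noteq> 0"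
  proof (rule ccontr)
    assume "\<not> (\<exists>a<2 ^ n. proj $$ (a,a) \<noteq> 0)"
    then have "tr proj = 0" by (simp add: tr_def)
    then show False by (simp add: tr_proj)
  qed
  then obtain a where a: "a < 2 ^ n" "proj $$ (a,a) \<noteq> 0" by blast
  \<comment> \<open>A matrix unit: column 0 of \<open>proj * E\<close> is column \<open>a\<close> of
    \<open>proj\<close>, whose entry in row \<open>a\<close> is nonzero.\<close>
  define E where "E = mat (2 ^ n) (2 ^ m) (\<lambda>(i,j). if i = a \<and> j = 0 then 1 else 0 :: complex)"
  have E: "dim_row E = 2 ^ n" "dim_col E = 2 ^ m" by (simp_all add: E_def)
  have "(proj * E) $$ (a,0) = (\<Sum>k<2 ^ n. proj $$ (a,k) * E $$ (k,0))"
    using a(1) E by (subst index_mult_sum) auto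
  also have "\<dots> = (\<Sum>k<2 ^ n. if k = a then proj $$ (a,a) else 0)"
    by (intro sum.cong refl) (auto simp: E_def)
  also have "\<dots> = proj $$ (a,a)" using a(1) by simp
  finally have "(proj * E) $$ (a,0) \<noteq> 0\<^sub>m (2 ^ n) (2 ^ m) $$ (a,0)" using a by simp
  then have "proj * E \<noteq> 0\<^sub>m (2 ^ n) (2 ^ m)" by metis
  moreover have "big.parity * (proj * E) = proj * E"
    using E by (subst mult_eq_assoc[OF parity_proj]) auto
  ultimately show ?case using E by (intro bexI[of _ "proj * E"]) auto
next
  case (Suc k)
  then obtain X where X: "X \<in> carrier_mat (2 ^ n) (2 ^ m)" "X \<noteq> 0\<^sub>m (2 ^ n) (2 ^ m)"
    "big.parity * X = X" "\<And>i. i \<in> {1..k} \<Longrightarrow> \<exists>e\<in>{1,-1}. B i * X * chi' i = e \<cdot>\<^sub>m X"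
    by force
  have i: "Suc k \<in> {1..2*m}" using Suc by auto
  note D = carrier_matD[OF X(1)] B.chi_dim[OF i] small.chi_dim[OF i]
  let ?Y = "B (Suc k) * X * chi' (Suc k)"
  have Y: "dim_row ?Y = 2 ^ n" "dim_col ?Y = 2 ^ m" using D by auto
  show ?case
  proof (cases "X + ?Y = 0\<^sub>m (2 ^ n) (2 ^ m)")
    case True
    have "?Y $$ (a,b) = - X $$ (a,b)" if "a < 2 ^ n" "b < 2 ^ m" for a b
    proof -
      have "(X + ?Y) $$ (a,b) = 0" using that by (simp add: True)
      then show ?thesis
        using that Y D by (simp add: eq_neg_iff_add_eq_0 add.commute del: index_mult_mat(1))
    qed
    then have "?Y = (-1) \<cdot>\<^sub>m X"
      using D Y by (intro eq_matI) (simp_all del: index_mult_mat(1))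
    then have "\<exists>e\<in>{1,-1}. B i * X * chi' i = e \<cdot>\<^sub>m X" if "i \<in> {1..Suc k}" for i
      using that X(4)[of i] by (cases "i = Suc k") auto
    then show ?thesis using X(1-3) by blast
  next
    case False
    \<comment> \<open>The earlier signs survive: \<open>B j\<close> passes \<open>B (Suc k)\<close>,
      \<open>chi' j\<close> passes \<open>chi' (Suc k)\<close>, and the two minus signs
      cancel.\<close>
    have *: "B j * (X + ?Y) * chi' j = e \<cdot>\<^sub>m (X + ?Y)"
      if j: "j \<in> {1..k}" and e: "B j * X * chi' j = e \<cdot>\<^sub>m X" for j e
    proof -
      have j': "j \<in> {1..2*m}" "j \<noteq> Suc k" using j Suc by auto
      note D' = D B.chi_dim[OF j'(1)] small.chi_dim[OF j'(1)]
      have "B j * ?Y * chi' j = (B j * B (Suc k)) * X * (chi' (Suc k) * chi' j)"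
        using D' by (simp add: mat_simps)
      also have "\<dots> = B (Suc k) * (B j * X * chi' j) * chi' (Suc k)"
        using D' B.chi_anti[OF j'(1) i j'(2)] small.chi_anti[OF i j'(1)] j'(2)
        by (simp add: sign_commutes_def mat_simps)
      also have "\<dots> = e \<cdot>\<^sub>m ?Y" unfolding e using D' by (simp add: mat_simps)
      finally show ?thesis
        using D' e Y by (simp add: mult_add_dim add_mult_dim smult_add_dim)
    qed
    have **: "B (Suc k) * (X + ?Y) * chi' (Suc k) = 1 \<cdot>\<^sub>m (X + ?Y)"
    proof -
      have "B (Suc k) * ?Y * chi' (Suc k) = X"
        using D B.chi_sq[OF i] small.chi_sq[OF i] by (simp add: mat_simps mult_inverse_cancel)
      then have "B (Suc k) * (X + ?Y) * chi' (Suc k) = ?Y + X"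
        using D Y by (simp add: mult_add_dim add_mult_dim)
      also have "\<dots> = 1 \<cdot>\<^sub>m (X + ?Y)"
        using D Y by (intro eq_matI) (auto simp: add.commute simp del: index_mult_mat(1))
      finally show ?thesis .
    qed
    have "\<exists>e\<in>{1,-1}. B i * (X + ?Y) * chi' i = e \<cdot>\<^sub>m (X + ?Y)" if "i \<in> {1..Suc k}" for i
    proof (cases "i = Suc k")
      case True
      then show ?thesis using ** by blast
    next
      case False
      then have i: "i \<in> {1..k}" using that by auto
      from X(4)[OF i] *[OF i] show ?thesis by blast
    qed
    moreover have "big.parity * (X + ?Y) = X + ?Y"
    proof -
      have "big.parity * ?Y = (big.parity * B (Suc k)) * X * chi' (Suc k)"
        using D by (simp add: mat_simps)
      also have "\<dots> = B (Suc k) * (big.parity * X) * chi' (Suc k)"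
        unfolding parity_commutes_B[OF i] using D by (simp add: mat_simps)
      also have "\<dots> = ?Y" by (simp add: X(3))
      finally show ?thesis using D Y X(3) by (simp add: mult_add_dim)
    qed
    moreover have "X + ?Y \<in> carrier_mat (2 ^ n) (2 ^ m)" using X(1) Y by auto
    ultimately show ?thesis
      using False by blast
  qed
qed

text \<open>Right multiplication of the signed intertwiner by a string gives a true intertwiner
  \<open>Y\<close>. Then \<open>adj Y * Y\<close> commutes with every \<open>chi' i\<close>, hence
  is a positive scalar, and scaling yields an isometry into the even sector. Equality of traces
  makes it onto.\<close>

lemma isometry_exists:
  obtains W where "W \<in> carrier_mat (2 ^ n) (2 ^ m)" "adj W * W = 1\<^sub>m (2 ^ m)"
    "W * adj W = proj" "\<And>i. i \<in> {1..2*m} \<Longrightarrow> B i * W = W * chi' i"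
proof -
  obtain X where X: "X \<in> carrier_mat (2 ^ n) (2 ^ m)" "X \<noteq> 0\<^sub>m (2 ^ n) (2 ^ m)"
    "big.parity * X = X" "\<And>i. i \<in> {1..2*m} \<Longrightarrow> \<exists>e\<in>{1,-1}. B i * X * chi' i = e \<cdot>\<^sub>m X"
    using signed_intertwiner[OF order_refl] by blast
  define F where "F = {i\<in>{1..2*m}. B i * X * chi' i = (-1) \<cdot>\<^sub>m X}"
  \<comment> \<open>The string whose signs against the \<open>chi' i\<close> are those of
    \<open>X\<close>, so that they cancel in \<open>Y\<close>.\<close>
  define s where "s = flip (2 * m) F"
  have F: "F \<subseteq> {1..2*m}" by (auto simp: F_def)
  have s: "s \<subseteq> {1..2*m}" using flip_subset[OF F] by (simp add: s_def)
  have flip_s: "flip (2 * m) s = F" by (simp add: s_def flip_flip[OF F])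
  let ?S = "small.string s"
  define Y where "Y = X * ?S"
  note DX = carrier_matD[OF X(1)]
  have Y: "dim_row Y = 2 ^ n" "dim_col Y = 2 ^ m" using DX by (auto simp: Y_def)
  have YB: "B i * Y = Y * chi' i" if i: "i \<in> {1..2*m}" for i
  proof -
    note D = DX B.chi_dim[OF i] small.chi_dim[OF i]
    define e where "e = (if i \<in> F then -1 else 1 :: complex)"
    have ee: "e * e = 1" by (simp add: e_def)
    have e1: "B i * X * chi' i = e \<cdot>\<^sub>m X"
      using X(4)[OF i] i by (auto simp: e_def F_def)
    have "sign_commutes e ?S (chi' i)"
      by (rule sign_commutes_sym[OF ee])
        (use small.sign_commutes_string[OF s i] in \<open>simp only: flip_s e_def\<close>)
    then have e2: "?S * chi' i = e \<cdot>\<^sub>m (chi' i * ?S)" by (simp add: sign_commutes_def)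
    have "B i * Y * chi' i = B i * X * (?S * chi' i)" using D by (simp add: Y_def mat_simps)
    also have "\<dots> = e \<cdot>\<^sub>m (B i * X * chi' i * ?S)" unfolding e2 using D by (simp add: mat_simps)
    also have "\<dots> = Y" unfolding e1 using D by (simp add: mat_simps ee Y_def)
    finally have "B i * Y * chi' i * chi' i = Y * chi' i" by simp
    then show ?thesis using D Y small.chi_sq[OF i] by (simp add: mat_simps)
  qed
  have "Y * adj ?S = X"
    using DX by (simp add: Y_def mat_simps unitary_matD(4)[OF small.unitary_string])
  then have Y0: "Y \<noteq> 0\<^sub>m (2 ^ n) (2 ^ m)" using X(2) by auto
  \<comment> \<open>The scalar value of \<open>adj Y * Y\<close>: its trace divided by the
    dimension.\<close>
  define r where "r = (\<Sum>i<2 ^ m. \<Sum>k<2 ^ n. (cmod (Y $$ (k,i)))\<^sup>2) / 2 ^ m"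
  have trY: "tr (adj Y * Y) / 2 ^ m = of_real r"
    by (simp add: tr_adj_mult_eq_sum Y r_def)
  have "tr (adj Y * Y) \<noteq> 0"
    using tr_adj_mult_eq_0[of Y "2 ^ n" "2 ^ m"] Y Y0 by auto
  then have "r \<noteq> 0" using trY by auto
  moreover have "r \<ge> 0" by (simp add: r_def sum_nonneg)
  ultimately have r: "r > 0" by simp
  have YY: "adj Y * Y = of_real r \<cdot>\<^sub>m 1\<^sub>m (2 ^ m)"
    unfolding trY[symmetric]
  proof (rule small.commutant_scalar)
    fix i assume i: "i \<in> {1..2*m}"
    note D = Y B.chi_dim[OF i] small.chi_dim[OF i]
    have "adj (Y * chi' i) = adj (B i * Y)" by (simp only: YB[OF i])
    then have "chi' i * adj Y = adj Y * B i"
      using D by (simp add: mat_simps small.chi_herm[OF i] B.chi_herm[OF i])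
    then have "chi' i * (adj Y * Y) = adj Y * B i * Y"
      using D by (intro mult_eq_assoc) auto
    then show "chi' i * (adj Y * Y) = adj Y * Y * chi' i"
      using D by (simp add: YB[OF i] mat_simps)
  qed (use Y in auto)
  define W where "W = of_real (1 / sqrt r) \<cdot>\<^sub>m Y"
  have W: "dim_row W = 2 ^ n" "dim_col W = 2 ^ m" by (simp_all add: W_def Y)
  have "of_real (1 / sqrt r) * (of_real (1 / sqrt r) * of_real r) = (1 :: complex)"
    using r by (simp flip: of_real_mult of_real_divide)
  then have WW: "adj W * W = 1\<^sub>m (2 ^ m)"
    using Y by (simp add: W_def mat_simps YY mult.assoc)
  have WB: "B i * W = W * chi' i" if i: "i \<in> {1..2*m}" for i
    using YB[OF i] Y B.chi_dim[OF i] small.chi_dim[OF i] by (simp add: W_def mat_simps)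
  have "big.parity * Y = Y"
    using DX by (simp add: Y_def mult_eq_assoc[OF X(3)])
  then have "big.parity * W = W" using Y by (simp add: W_def mat_simps)
  then have pW: "proj * W = W" by (rule proj_eq_if_parity_eq[OF W(1)])
  have "adj (proj * W) = adj W" by (simp only: pW)
  then have Wp: "adj W * proj = adj W" using W by (simp add: mat_simps proj_herm)
  \<comment> \<open>The part of the even sector missed by \<open>W\<close>. It is Hermitian and
    idempotent, and its trace is \<open>2 ^ m - 2 ^ m\<close>, so definiteness of the trace form
    makes it vanish.\<close>
  define D where "D = proj + (-1) \<cdot>\<^sub>m (W * adj W)"
  have D: "D \<in> carrier_mat (2 ^ n) (2 ^ n)" using W by (auto simp: D_def)
  have pp: "proj * proj = proj" by (rule proj_eq_if_parity_eq[OF proj_dim(1) parity_proj])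
  have "adj D * D = D"
  proof -
    have 1: "adj D = D" using W by (simp add: D_def adj_add mat_simps proj_herm)
    have 2: "proj * D = D"
      using W by (simp add: D_def mult_add_dim mat_simps pp mult_eq_assoc[OF pW])
    have "adj W * D = 0\<^sub>m (2 ^ m) (2 ^ n)"
      using W by (simp add: D_def mult_add_dim mat_simps Wp mult_eq_assoc[OF WW]) (auto intro: eq_matI)
    then have "W * adj W * D = 0\<^sub>m (2 ^ n) (2 ^ n)"
      using W D by (simp add: mat_simps)
    then have "D * D = D + (-1) \<cdot>\<^sub>m 0\<^sub>m (2 ^ n) (2 ^ n)"
      using W D 2 by (subst (1) D_def) (simp add: add_mult_dim smult_mult_left_dim)
    also have "\<dots> = D" using D by (intro eq_matI) auto
    finally show ?thesis by (simp add: 1)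
  qed
  moreover have "tr D = 0"
  proof -
    have "tr (W * adj W) = 2 ^ m" using W by (subst tr_mult_comm) (auto simp: WW)
    then show ?thesis
      unfolding D_def using W by (subst tr_add[of _ "2 ^ n"]) (auto simp: tr_smult tr_proj)
  qed
  ultimately have D0: "D = 0\<^sub>m (2 ^ n) (2 ^ n)"
    using tr_adj_mult_eq_0[OF D] by simp
  have "W * adj W = proj"
  proof (rule eq_matI)
    fix a b assume ab: "a < dim_row proj" "b < dim_col proj"
    then have "D $$ (a,b) = 0" by (simp add: D0)
    then show "(W * adj W) $$ (a,b) = proj $$ (a,b)"
      using ab W by (simp add: D_def del: index_mult_mat(1))
  qed (use W in auto)
  then show ?thesis using that W WW WB by auto
qed

end

section \<open>Compression to the even sector\<close>

locale parity_isometry = parity_reduction n m chi chi' for n m chi chi' +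
  fixes W
  assumes W_carrier: "W \<in> carrier_mat (2 ^ n) (2 ^ m)"
    and WW: "adj W * W = 1\<^sub>m (2 ^ m)"
    and W_proj: "W * adj W = proj"
    and B_W: "i \<in> {1..2*m} \<Longrightarrow> B i * W = W * chi' i"
begin

definition red :: "complex mat \<Rightarrow> complex mat" where
  "red U = adj W * U * W"

definition lift :: "complex mat \<Rightarrow> complex mat" where
  "lift h = W * h * adj W + kappa * (W * h * adj W) * kappa"

lemma W_dim [simp]: "dim_row W = 2 ^ n" "dim_col W = 2 ^ m"
  using W_carrier by auto

lemma WW_cancel: "dim_row X = 2 ^ m \<Longrightarrow> adj W * (W * X) = X"
  by (rule mult_inverse_cancel[OF WW]) auto

lemma kappa_cancel: "dim_row X = 2 ^ n \<Longrightarrow> kappa * (kappa * X) = X"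
  by (rule mult_inverse_cancel[OF chi_simps(6)]) (simp_all only: chi_simps)

lemma proj_W: "proj * W = W"
  unfolding W_proj[symmetric] by (simp add: mat_simps WW)

lemma parity_W: "big.parity * W = W"
proof -
  have "big.parity * (proj * W) = proj * W"
    by (rule mult_eq_assoc[OF parity_proj]) auto
  then show ?thesis by (simp add: proj_W)
qed

lemma adj_W_parity: "adj W * big.parity = adj W"
proof -
  have "adj (big.parity * W) = adj W" by (simp only: parity_W)
  then show ?thesis by (simp add: mat_simps big.parity_herm)
qed

lemma adj_W_B:
  assumes i: "i \<in> {1..2*m}"
  shows "adj W * B i = chi' i * adj W"
proof -
  have "adj (B i * W) = adj (W * chi' i)" by (simp only: B_W[OF i])
  then show ?thesis
    using B.chi_dim[OF i] small.chi_dim[OF i]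
    by (simp add: mat_simps B.chi_herm[OF i] small.chi_herm[OF i])
qed

text \<open>\<open>kappa\<close> maps the even sector to the odd one, which is orthogonal to it.
  Algebraically, inserting the parity next to \<open>W\<close> and moving it past
  \<open>kappa\<close> shows that the product equals its own negative.\<close>

lemma W_kappa_W: "adj W * (kappa * W) = 0\<^sub>m (2 ^ m) (2 ^ m)"
proof -
  let ?Z = "adj W * (kappa * W)"
  have "?Z = adj W * ((kappa * big.parity) * W)"
    using chi_simps by (simp add: mat_simps parity_W)
  also have "\<dots> = (-1) \<cdot>\<^sub>m (adj W * big.parity * (kappa * W))"
    unfolding kappa_parity using chi_simps by (simp add: mat_simps)
  also have "\<dots> = (-1) \<cdot>\<^sub>m ?Z" by (simp only: adj_W_parity)
  finally have *: "?Z = (-1) \<cdot>\<^sub>m ?Z" .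
  have Z: "dim_row ?Z = 2 ^ m" "dim_col ?Z = 2 ^ m" by auto
  show ?thesis
  proof (rule eq_matI)
    fix i j assume "i < dim_row (0\<^sub>m (2 ^ m) (2 ^ m) :: complex mat)"
      "j < dim_col (0\<^sub>m (2 ^ m) (2 ^ m) :: complex mat)"
    then have ij: "i < 2 ^ m" "j < 2 ^ m" by auto
    have "?Z $$ (i,j) = ((-1) \<cdot>\<^sub>m ?Z) $$ (i,j)" using * by (rule arg_cong)
    also have "\<dots> = - (?Z $$ (i,j))"
      using ij Z by (simp del: index_mult_mat(1))
    finally show "?Z $$ (i,j) = 0\<^sub>m (2 ^ m) (2 ^ m) $$ (i,j)"
      using ij by (simp del: index_mult_mat(1))
  qed (use Z in auto)
qed

lemma W_kappa_W_cancel: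
  "dim_row X = 2 ^ m \<Longrightarrow> adj W * (kappa * (W * X)) = 0\<^sub>m (2 ^ m) (dim_col X)"
  using mult_eq_assoc[OF W_kappa_W, of X] chi_simps by (simp add: mat_mult_assoc_dim)

text \<open>The inner \<open>W * adj W\<close> is \<open>proj\<close>; it moves past
  \<open>V\<close>, which preserves parity, and is absorbed by \<open>W\<close>.\<close>

lemma red_mult:
  assumes U: "U \<in> carrier_mat (2 ^ n) (2 ^ n)"
    and V: "V \<in> carrier_mat (2 ^ n) (2 ^ n)" "V * big.parity = big.parity * V"
  shows "red (U * V) = red U * red V"
proof -
  note D = carrier_matD[OF U] carrier_matD[OF V(1)]
  have "red U * red V = adj W * U * ((W * adj W) * V) * W"
    using D by (simp add: red_def mat_simps)
  also have "(W * adj W) * V = V * proj"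
    by (simp only: W_proj commutes_proj[OF V])
  also have "adj W * U * (V * proj) * W = red (U * V)"
    using D by (simp add: red_def mat_simps proj_W)
  finally show ?thesis by simp
qed

lemma red_adj: "U \<in> carrier_mat (2 ^ n) (2 ^ n) \<Longrightarrow> red (adj U) = adj (red U)"
  by (auto simp: red_def mat_simps)

lemma red_smult: "U \<in> carrier_mat (2 ^ n) (2 ^ n) \<Longrightarrow> red (c \<cdot>\<^sub>m U) = c \<cdot>\<^sub>m red U"
  by (auto simp: red_def mat_simps)

lemma red_carrier: "U \<in> carrier_mat (2 ^ n) (2 ^ n) \<Longrightarrow> red U \<in> carrier_mat (2 ^ m) (2 ^ m)"
  by (auto simp: red_def)

lemma red_one: "red (1\<^sub>m (2 ^ n)) = 1\<^sub>m (2 ^ m)"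
  by (simp add: red_def WW)

lemma p_cliffordD:
  assumes "U \<in> p_clifford n chi"
  shows "unitary_mat (2 ^ n) U" "U \<in> carrier_mat (2 ^ n) (2 ^ n)" "U * big.parity = big.parity * U"
    "U \<in> majorana_clifford n chi"
  using assms big.clifford_unitary unitary_matD(1) by (auto simp: big.p_clifford_eq)

lemma red_unitary:
  assumes U: "U \<in> p_clifford n chi"
  shows "unitary_mat (2 ^ m) (red U)"
proof -
  note D = p_cliffordD[OF U] p_cliffordD[OF big.p_clifford_adj[OF U]]
  show ?thesis
    using red_mult[OF D(2,6,7)] red_mult[OF D(6,2,3)] red_carrier[OF D(2)]
    by (simp add: unitary_mat_def red_adj[OF D(2)] unitary_matD[OF D(1)] red_one)
qed

text \<open>\<open>A\<close> and \<open>B i\<close> both lie in \<open>big.SC\<close>, so they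
  commute up to sign, and the intertwining relation turns \<open>B i\<close> into
  \<open>chi' i\<close>. An odd \<open>A\<close> compresses to 0, which is also in
  \<open>small.SC\<close>.\<close>

lemma red_SC:
  assumes A: "A \<in> big.SC"
  shows "red A \<in> small.SC"
  unfolding sign_centralizer_def
proof (intro CollectI conjI ballI)
  note Ac = sign_centralizer_carrier[OF A]
  show "red A \<in> carrier_mat (2 ^ m) (2 ^ m)" by (rule red_carrier[OF Ac])
  fix i assume i: "i \<in> {1..2*m}"
  note D = carrier_matD[OF Ac] B.chi_dim[OF i] small.chi_dim[OF i]
  obtain s where s: "s \<in> {1,-1}" "B i * A = s \<cdot>\<^sub>m (A * B i)"
    using big.SC_sign_commute[OF B_in_SC[OF i] A] unfolding sign_commutes_def by blast
  have "chi' i * red A = (chi' i * adj W) * A * W" using D by (simp add: red_def mat_simps)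
  also have "\<dots> = adj W * (B i * A) * W"
    unfolding adj_W_B[OF i, symmetric] using D by (simp add: mat_simps)
  also have "\<dots> = s \<cdot>\<^sub>m (adj W * A * (B i * W))" unfolding s(2) using D by (simp add: mat_simps)
  also have "\<dots> = s \<cdot>\<^sub>m (red A * chi' i)"
    unfolding B_W[OF i] using D by (simp add: red_def mat_simps)
  finally show "\<exists>s\<in>{1,-1}. sign_commutes s (chi' i) (red A)"
    using s(1) by (auto simp: sign_commutes_def)
qed

lemma ordered_prod_B_W:
  "k \<le> 2 * m \<Longrightarrow> ordered_prod (2 ^ n) B v k * W = W * ordered_prod (2 ^ m) chi' v k"
proof (induction k)
  case (Suc k)
  then have i: "Suc k \<in> {1..2*m}" by auto
  note D = B.chi_dim[OF i] small.chi_dim[OF i]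
  have c: "dim_row (ordered_prod (2 ^ n) B v k) = 2 ^ n" "dim_col (ordered_prod (2 ^ n) B v k) = 2 ^ n"
    "dim_row (ordered_prod (2 ^ m) chi' v k) = 2 ^ m" "dim_col (ordered_prod (2 ^ m) chi' v k) = 2 ^ m"
    using Suc.prems carrier_matD[OF B.ordered_prod_carrier[of k v]]
      carrier_matD[OF small.ordered_prod_carrier[of k v]] by simp_all
  have "ordered_prod (2 ^ n) B v k * (B (Suc k) * W) = (ordered_prod (2 ^ n) B v k * W) * chi' (Suc k)"
    unfolding B_W[OF i] using c D by (simp add: mat_simps)
  also have "\<dots> = W * (ordered_prod (2 ^ m) chi' v k * chi' (Suc k))"
    using Suc c D by (simp add: mat_simps)
  finally show ?case using Suc c D by (simp add: mat_simps)
qed simp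

lemma string_B_W: "B.string s * W = W * small.string s"
  unfolding B.string_def small.string_def by (rule ordered_prod_B_W) simp

lemma string_B_SC: "B.string s \<in> big.SC"
proof -
  have "ordered_prod (2 ^ n) B v k \<in> big.SC" if "k \<le> 2 * m" for k v
    using that
  proof (induction k)
    case 0
    then show ?case using big.ordered_prod_in_sign_centralizer[of 0] by simp
  next
    case (Suc k)
    then show ?case by (auto intro!: big.sign_centralizer_mult B_in_SC)
  qed
  then show ?thesis by (simp add: B.string_def)
qed

text \<open>A string on the small space is the compression of the corresponding string in the
  \<open>B i\<close>, which lies in \<open>big.SC\<close>. Conjugation by \<open>U\<close> keeps it
  there, and compression returns to \<open>small.SC\<close>.\<close>

lemma red_clifford:
  assumes U: "U \<in> p_clifford n chi"
  shows "red U \<in> majorana_clifford m chi'"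
proof (rule small.cliffordI[OF red_unitary[OF U]])
  note UD = p_cliffordD[OF U]
  note VD = p_cliffordD[OF big.p_clifford_adj[OF U]]
  note D = carrier_matD[OF UD(2)]
  fix A assume "A \<in> small.SC"
  then obtain c s where A: "A = c \<cdot>\<^sub>m small.string s"
    by (rule small.sign_centralizer_eq_strings)
  have "red U * A * adj (red U) = c \<cdot>\<^sub>m (adj W * U * (W * small.string s) * adj W * adj U * W)"
    using D by (simp add: red_def A mat_simps)
  also have "\<dots> = c \<cdot>\<^sub>m (adj W * U * B.string s * ((W * adj W) * adj U) * W)"
    unfolding string_B_W[symmetric] using D by (simp add: mat_simps)
  also have "(W * adj W) * adj U = adj U * proj"
    by (simp only: W_proj commutes_proj[OF VD(2,3)])
  also have "adj W * U * B.string s * (adj U * proj) * W = red (U * B.string s * adj U)"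
    using D by (simp add: red_def mat_simps proj_W)
  finally show "red U * A * adj (red U) \<in> small.SC"
    by (simp add: small.sign_centralizer_smult red_SC big.clifford_conj_SC[OF UD(4) string_B_SC])
qed

section \<open>Extension of operators from the even sector to the whole space\<close>

lemma lift_carrier: "h \<in> carrier_mat (2 ^ m) (2 ^ m) \<Longrightarrow> lift h \<in> carrier_mat (2 ^ n) (2 ^ n)"
  using chi_simps by (auto simp: lift_def)

text \<open>Both summands of a lift are blocks on orthogonal sectors: the cross terms contain
  \<open>adj W * kappa * W = 0\<close>, and in the odd block
  \<open>kappa * kappa = 1\<close>.\<close>

lemma lift_mult:
  assumes "g \<in> carrier_mat (2 ^ m) (2 ^ m)" "h \<in> carrier_mat (2 ^ m) (2 ^ m)"
  shows "lift g * lift h = lift (g * h)"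
proof -
  note D = assms[THEN carrier_matD(1)] assms[THEN carrier_matD(2)]
  let ?G = "W * g * adj W" and ?H = "W * h * adj W"
  have G: "dim_row ?G = 2 ^ n" "dim_col ?G = 2 ^ n" "dim_row ?H = 2 ^ n" "dim_col ?H = 2 ^ n"
    by auto
  have zero: "X * kappa * Y = 0\<^sub>m (2 ^ n) (2 ^ n)"
    if "X \<in> {?G, ?H}" "Y \<in> {?G, ?H}" for X Y
    using that D chi_simps by (auto simp: mat_simps W_kappa_W_cancel)
  have add_zero: "X + 0\<^sub>m (2 ^ n) (2 ^ n) = X" "0\<^sub>m (2 ^ n) (2 ^ n) + X = X"
    if "dim_row X = 2 ^ n" "dim_col X = 2 ^ n" for X :: "complex mat"
    using that by (auto intro!: eq_matI)
  have 1: "?G * ?H = W * (g * h) * adj W"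
    using D by (simp add: mat_simps WW_cancel)
  have "lift g * lift h = ?G * ?H + kappa * (?G * kappa * ?H)
      + ((?G * kappa * ?H) * kappa + kappa * (?G * (kappa * kappa) * ?H) * kappa)"
    using G chi_simps unfolding lift_def
    by (simp add: mult_add_dim add_mult_dim mat_mult_assoc_dim kappa_cancel)
  also have "\<dots> = lift (g * h)"
    using G chi_simps zero[of ?G ?H]
    by (simp add: lift_def 1 D add_zero)
  finally show ?thesis .
qed

lemma lift_one: "lift (1\<^sub>m (2 ^ m)) = 1\<^sub>m (2 ^ n)"
  using proj_plus_kappa_proj_kappa chi_simps by (simp add: lift_def W_proj mat_mult_assoc_dim)

lemma lift_smult: "h \<in> carrier_mat (2 ^ m) (2 ^ m) \<Longrightarrow> lift (c \<cdot>\<^sub>m h) = c \<cdot>\<^sub>m lift h"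
  using chi_simps by (auto simp: lift_def mat_simps smult_add_dim)

lemma lift_adj: "h \<in> carrier_mat (2 ^ m) (2 ^ m) \<Longrightarrow> lift (adj h) = adj (lift h)"
  using chi_simps by (auto simp: lift_def adj_add mat_simps)

lemma lift_unitary:
  assumes "unitary_mat (2 ^ m) h"
  shows "unitary_mat (2 ^ n) (lift h)"
  using unitary_matD[OF assms]
  by (auto simp: unitary_mat_def lift_carrier lift_mult lift_one simp flip: lift_adj)

text \<open>The even block is \<open>B.string s * proj\<close>. Since \<open>kappa\<close> commutes
  with the \<open>B i\<close>, the odd block is the same string times the complementary
  projection.\<close>

lemma lift_string: "lift (small.string s) = B.string s"
proof -
  have kB: "kappa * B.string s = B.string s * kappa"
  proof -
    have "sign_commutes (\<Prod>i\<in>{i\<in>{1..2*m}. i \<in> s}. 1) kappa (B.string s)"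
      unfolding B.string_def
    proof (rule B.sign_commutes_ordered_prod)
      show "kappa \<in> carrier_mat (2 ^ n) (2 ^ n)" by (intro big.chi_carrier index_simps)
    qed (auto simp: sign_commutes_def one_smult_mat kappa_commutes_B)
    then show ?thesis by (simp add: sign_commutes_def one_smult_mat)
  qed
  have "lift (small.string s) = (B.string s * W) * adj W + kappa * ((B.string s * W) * adj W) * kappa"
    by (simp only: lift_def string_B_W)
  also have "\<dots> = B.string s * proj + (kappa * B.string s) * (proj * kappa)"
    using chi_simps by (simp add: mat_simps W_proj)
  also have "\<dots> = B.string s * (proj + kappa * (proj * kappa))"
    unfolding kB using chi_simps by (simp add: mat_simps mult_add_dim)
  also have "\<dots> = B.string s"
    by (simp add: proj_plus_kappa_proj_kappa)
  finally show ?thesis .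
qed

lemma lift_SC:
  assumes "A \<in> small.SC"
  shows "lift A \<in> big.SC"
proof -
  obtain c s where A: "A = c \<cdot>\<^sub>m small.string s"
    using small.sign_centralizer_eq_strings[OF assms] .
  show ?thesis
    by (simp add: A lift_smult lift_string big.sign_centralizer_smult string_B_SC)
qed

text \<open>Conjugation by \<open>kappa\<close> exchanges the two summands of the lift.\<close>

lemma lift_commutes_kappa:
  assumes "h \<in> carrier_mat (2 ^ m) (2 ^ m)"
  shows "lift h * kappa = kappa * lift h"
proof -
  let ?H = "W * h * adj W"
  have H: "dim_row ?H = 2 ^ n" "dim_col ?H = 2 ^ n" by auto
  have 1: "lift h * kappa = ?H * kappa + kappa * ?H"
    using H chi_simps unfolding lift_def by (simp add: add_mult_dim mat_mult_assoc_dim)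
  have 2: "kappa * lift h = kappa * ?H + ?H * kappa"
    using H chi_simps unfolding lift_def
    by (simp add: mult_add_dim mat_mult_assoc_dim kappa_cancel)
  show ?thesis unfolding 1 2 using H chi_simps by (intro comm_add_mat[of _ "2 ^ n" "2 ^ n"]) auto
qed

lemma lift_commutes_parity:
  assumes h: "h \<in> carrier_mat (2 ^ m) (2 ^ m)"
  shows "lift h * big.parity = big.parity * lift h"
proof -
  let ?H = "W * h * adj W"
  have H: "dim_row ?H = 2 ^ n" "dim_col ?H = 2 ^ n" by auto
  have PH: "big.parity * ?H = ?H"
  proof -
    have "big.parity * (W * (h * adj W)) = W * (h * adj W)"
      using h by (intro mult_eq_assoc[OF parity_W]) auto
    then show ?thesis using h by (simp add: mat_mult_assoc_dim)
  qed
  have HP: "?H * big.parity = ?H"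
    using h by (simp add: mat_mult_assoc_dim adj_W_parity)
  have pk: "big.parity * kappa = (-1) \<cdot>\<^sub>m (kappa * big.parity)"
    unfolding kappa_parity by (simp add: mat_simps)
  have "lift h * big.parity = ?H * big.parity + kappa * ?H * (kappa * big.parity)"
    using H chi_simps unfolding lift_def by (simp add: add_mult_dim mat_mult_assoc_dim)
  also have "\<dots> = ?H + (-1) \<cdot>\<^sub>m (kappa * (?H * big.parity) * kappa)"
    unfolding kappa_parity HP using H chi_simps HP
    by (simp add: mat_simps flip: mat_mult_assoc_dim[of ?H])
  also have "\<dots> = big.parity * ?H + (-1) \<cdot>\<^sub>m (kappa * (big.parity * ?H) * kappa)"
    by (simp only: PH HP)
  also have "\<dots> = big.parity * ?H + (big.parity * kappa) * ?H * kappa"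
    unfolding pk using H chi_simps by (simp add: mat_simps)
  also have "\<dots> = big.parity * lift h"
    using H chi_simps unfolding lift_def by (simp add: mult_add_dim mat_mult_assoc_dim)
  finally show ?thesis .
qed

lemma red_lift:
  assumes h: "h \<in> carrier_mat (2 ^ m) (2 ^ m)"
  shows "red (lift h) = h"
proof -
  have "red (lift h) = adj W * (W * (h * (adj W * W)))
      + adj W * (kappa * (W * (h * (adj W * (kappa * W)))))"
    using h chi_simps unfolding red_def lift_def
    by (simp add: mult_add_dim add_mult_dim mat_mult_assoc_dim)
  also have "\<dots> = h + 0\<^sub>m (2 ^ m) (2 ^ m)"
    using h by (simp add: WW WW_cancel W_kappa_W_cancel)
  finally show ?thesis using h by simp
qed

text \<open>Together with the parity and \<open>kappa\<close>, the \<open>B\<^sub>i\<close> generate all \<open>\<chi>\<^sub>i\<close>: the last one by this lemma, the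
  others since \<open>\<chi>\<^sub>i\<close> is a multiple of \<open>B\<^sub>i \<chi>\<^sub>2\<^sub>n\<close>.\<close>
lemma last_chi_eq:
  obtains c where "last_chi = c \<cdot>\<^sub>m adj (kappa * (big.parity * B.string {1..2*m}))"
proof -
  let ?Q = "B.string {1..2*m}"
  define R where "R = kappa * (big.parity * ?Q)"
  have lc: "last_chi \<in> carrier_mat (2 ^ n) (2 ^ n)" and kc: "kappa \<in> carrier_mat (2 ^ n) (2 ^ n)"
    by (intro big.chi_carrier index_simps)+
  have Rc: "R \<in> carrier_mat (2 ^ n) (2 ^ n)"
    unfolding R_def by (intro mult_carrier_mat[of _ _ "2 ^ n"] kc big.parity_carrier B.string_carrier)
  have "chi j * (last_chi * R) = (last_chi * R) * chi j" if j: "j \<in> {1..2*n}" for j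
  proof -
    note jc = big.chi_carrier[OF j]
    \<comment> \<open>Signs of \<open>chi j\<close> against \<open>last_chi\<close>,
      \<open>kappa\<close> and \<open>?Q\<close>. Together with the -1 from the parity their product
      is 1 for each position of \<open>j\<close>, so \<open>last_chi * R\<close> is scalar by
      Schur's lemma.\<close>
    let ?l = "if j = 2 * n then 1 else -1 :: complex"
    let ?k = "if j = Suc (2 * m) then 1 else -1 :: complex"
    let ?q = "if j \<in> {1..2*m} then -1 else 1 :: complex"
    have jj: "j \<in> {1..2*m} \<or> j = Suc (2 * m) \<or> j = 2 * n" using j by (auto simp: n_eq)
    have chi_sc: "sign_commutes (if j = i then 1 else -1) (chi j) (chi i)" if "i \<in> {1..2*n}" for i
      using big.chi_anti[OF j that] sign_commutes_self by auto
    have sB: "sign_commutes ((if j = i then 1 else -1) * ?l) (chi j) (B i)" if "i \<in> {1..2*m}" for i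
      by (intro sign_commutes_chi_B jc that chi_sc index_simps)
    have "sign_commutes (\<Prod>i\<in>{i\<in>{1..2*m}. i \<in> {1..2*m}}. (if j = i then 1 else -1) * ?l) (chi j) ?Q"
      unfolding B.string_def by (rule B.sign_commutes_ordered_prod[OF jc order_refl sB])
    \<comment> \<open>For \<open>j\<close> at most \<open>2 * m\<close> only \<open>B j\<close>
      contributes -1. For \<open>kappa\<close> every sign is 1, and for \<open>last_chi\<close>
      there are \<open>2 * m\<close> signs -1, an even number.\<close>
    moreover have "(\<Prod>i\<in>{i\<in>{1..2*m}. i \<in> {1..2*m}}. (if j = i then 1 else -1) * ?l) = ?q"
    proof -
      have *: "{i\<in>{1..2*m}. i \<in> {1..2*m}} = {1..2*m}" by auto
      consider "j \<in> {1..2*m}" | "j = Suc (2 * m)" | "j = 2 * n" using jj by blast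
      then show ?thesis
      proof cases
        case 1
        then have "(\<Prod>i\<in>{1..2*m}. (if j = i then 1 else -1) * ?l) = (\<Prod>i\<in>{1..2*m}. if i = j then -1 else 1)"
          by (intro prod.cong refl) (auto simp: index_simps)
        then show ?thesis using 1 by (simp only: *) (simp add: prod.delta)
      next
        case 2
        then have "(\<Prod>i\<in>{1..2*m}. (if j = i then 1 else -1) * ?l) = (\<Prod>i\<in>{1..2*m}. 1)"
          by (intro prod.cong refl) (auto simp: n_eq)
        then show ?thesis using 2 by (simp only: *) simp
      next
        case 3
        then have "(\<Prod>i\<in>{1..2*m}. (if j = i then 1 else -1) * ?l) = (\<Prod>i\<in>{1..2*m}. -1)"
          by (intro prod.cong refl) (auto simp: n_eq)
        then show ?thesis using 3 by (simp only: *) (simp add: n_eq)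
      qed
    qed
    ultimately have sQ: "sign_commutes ?q (chi j) ?Q" by simp
    have "sign_commutes (?l * (?k * (-1 * ?q))) (chi j) (last_chi * R)"
      unfolding R_def
      by (intro sign_commutes_mult_right[OF jc] lc kc chi_sc index_simps sQ
          big.parity_anticommutes_chi[OF j] big.parity_carrier B.string_carrier
          mult_carrier_mat[of _ _ "2 ^ n"])
    moreover have "?l * (?k * (-1 * ?q)) = 1"
      using jj by (auto simp: n_eq)
    ultimately show ?thesis by (simp add: sign_commutes_def one_smult_mat)
  qed
  then have *: "last_chi * R = (tr (last_chi * R) / 2 ^ n) \<cdot>\<^sub>m 1\<^sub>m (2 ^ n)"
    by (intro big.commutant_scalar mult_carrier_mat[OF lc Rc])
  have "unitary_mat (2 ^ n) R"
    unfolding R_def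
    by (intro unitary_mat_mult big.chi_unitary index_simps big.parity_unitary B.unitary_string)
  then have R: "R * adj R = 1\<^sub>m (2 ^ n)" by (rule unitary_matD)
  have "last_chi = last_chi * (R * adj R)" using lc by (simp add: R)
  also have "\<dots> = last_chi * R * adj R"
    using carrier_matD[OF lc] carrier_matD[OF Rc] by (simp add: mat_mult_assoc_dim)
  also have "\<dots> = (tr (last_chi * R) / 2 ^ n) \<cdot>\<^sub>m adj R"
    using carrier_matD[OF Rc] by (subst *) (simp add: mat_simps)
  finally show ?thesis using that unfolding R_def by blast
qed

text \<open>It suffices to test generators under conjugation. The lift commutes with
  \<open>kappa\<close> and the parity, and sends lifts of elements of \<open>small.SC\<close>, among
  them the \<open>B i\<close> and their strings, to such lifts. All \<open>chi i\<close> are built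
  from these.\<close>

lemma lift_p_clifford:
  assumes h: "h \<in> majorana_clifford m chi'"
  shows "lift h \<in> p_clifford n chi"
proof -
  note hU = small.clifford_unitary[OF h]
  note hc = unitary_matD(1)[OF hU]
  define L where "L = lift h"
  note LU = lift_unitary[OF hU, folded L_def]
  note LD = unitary_matD[OF LU]
  \<comment> \<open>Conjugation by the inverse of \<open>L\<close>, the direction used by
    \<open>cliffordI_generators\<close>.\<close>
  define cj where "cj A = adj L * A * L" for A
  have cj_mult: "cj (A * C) = cj A * cj C"
    if "A \<in> carrier_mat (2 ^ n) (2 ^ n)" "C \<in> carrier_mat (2 ^ n) (2 ^ n)" for A C
    using that LD by (simp add: cj_def mat_simps mult_inverse_cancel[OF LD(4)])
  have cj_adj: "cj (adj A) = adj (cj A)" if "A \<in> carrier_mat (2 ^ n) (2 ^ n)" for A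
    using that LD by (simp add: cj_def mat_simps)
  have cj_smult: "cj (c \<cdot>\<^sub>m A) = c \<cdot>\<^sub>m cj A" if "A \<in> carrier_mat (2 ^ n) (2 ^ n)" for A c
    using that LD by (simp add: cj_def mat_simps)
  have cj_comm: "cj A = A" if "A \<in> carrier_mat (2 ^ n) (2 ^ n)" "L * A = A * L" for A
  proof -
    have "cj A = adj L * (L * A)" using that LD by (simp add: cj_def mat_mult_assoc_dim)
    then show ?thesis using that(1) LD by (simp add: mult_inverse_cancel[OF LD(5)])
  qed
  have cj_lift: "cj (lift A) \<in> big.SC" if A: "A \<in> small.SC" for A
  proof -
    note Ac = sign_centralizer_carrier[OF A]
    have "cj (lift A) = lift (adj h * A * adj (adj h))"
      using hc Ac lift_mult[OF mult_carrier_mat[OF adj_carrier[OF hc] Ac] hc]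
      by (simp add: cj_def L_def lift_mult flip: lift_adj)
    then show ?thesis
      using lift_SC small.clifford_conj_SC[OF small.clifford_adj[OF h] A] by simp
  qed
  have lc: "last_chi \<in> carrier_mat (2 ^ n) (2 ^ n)" and kc: "kappa \<in> carrier_mat (2 ^ n) (2 ^ n)"
    by (intro big.chi_carrier index_simps)+
  have cj_kappa: "cj kappa \<in> big.SC"
    using cj_comm[OF kc] lift_commutes_kappa[OF hc] big.chi_in_sign_centralizer[OF index_simps(2)]
    by (simp add: L_def)
  have cj_parity: "cj big.parity \<in> big.SC"
    using cj_comm[OF big.parity_carrier] lift_commutes_parity[OF hc] big.parity_SC
    by (simp add: L_def)
  have cj_string: "cj (B.string s) \<in> big.SC" for s
    unfolding lift_string[symmetric]
    by (intro cj_lift) (simp add: small.string_def small.ordered_prod_in_sign_centralizer)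
  have cj_B: "cj (B i) \<in> big.SC" if i: "i \<in> {1..2*m}" for i
  proof -
    have "B i * proj = W * chi' i * adj W"
      using B.chi_dim[OF i] small.chi_dim[OF i]
      by (simp add: W_proj[symmetric] B_W[OF i, symmetric] mat_mult_assoc_dim)
    then have "lift (chi' i) = B i * proj + kappa * (B i * proj) * kappa"
      by (simp only: lift_def)
    also have "\<dots> = B i * proj + (kappa * B i) * (proj * kappa)"
      using B.chi_dim[OF i] chi_simps by (simp add: mat_mult_assoc_dim)
    also have "\<dots> = B i * (proj + kappa * (proj * kappa))"
      unfolding kappa_commutes_B[OF i] using B.chi_dim[OF i] chi_simps
      by (simp add: mat_mult_assoc_dim mult_add_dim)
    also have "\<dots> = B i"
      using B.chi_dim[OF i] by (simp add: proj_plus_kappa_proj_kappa)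
    finally show ?thesis
      using cj_lift[OF small.chi_in_sign_centralizer[OF i]] by simp
  qed
  have cj_last: "cj last_chi \<in> big.SC"
  proof -
    let ?R = "kappa * (big.parity * B.string {1..2*m})"
    obtain c where c: "last_chi = c \<cdot>\<^sub>m adj ?R" by (rule last_chi_eq)
    have PQ: "big.parity * B.string {1..2*m} \<in> carrier_mat (2 ^ n) (2 ^ n)"
      by (intro mult_carrier_mat[of _ _ "2 ^ n"] big.parity_carrier B.string_carrier)
    have R: "?R \<in> carrier_mat (2 ^ n) (2 ^ n)"
      by (intro mult_carrier_mat[of _ _ "2 ^ n"] kc PQ)
    have "cj ?R = cj kappa * (cj big.parity * cj (B.string {1..2*m}))"
      by (simp only: cj_mult[OF kc PQ] cj_mult[OF big.parity_carrier B.string_carrier])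
    then have "cj ?R \<in> big.SC"
      by (simp only: big.sign_centralizer_mult cj_kappa cj_parity cj_string)
    then have "c \<cdot>\<^sub>m adj (cj ?R) \<in> big.SC"
      by (intro big.sign_centralizer_smult big.sign_centralizer_adj)
    then show ?thesis
      by (subst c) (simp only: cj_smult[OF adj_carrier[OF R]] cj_adj[OF R])
  qed
  have "L \<in> majorana_clifford n chi"
  proof (rule big.cliffordI_generators[OF LU], fold cj_def)
    fix i assume i: "i \<in> {1..2*n}"
    then have "i \<in> {1..2*m} \<or> i = Suc (2 * m) \<or> i = 2 * n" by (auto simp: n_eq)
    then consider "i \<in> {1..2*m}" | "i = Suc (2 * m)" | "i = 2 * n" by blast
    then show "cj (chi i) \<in> big.SC"
    proof cases
      case 1
      \<comment> \<open>Solves the definition of \<open>B i\<close> for \<open>chi i\<close>, using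
        that \<open>last_chi\<close> squares to 1.\<close>
      have "chi i = (-\<i>) \<cdot>\<^sub>m (B i * last_chi)"
        using chi_dim_small[OF 1] chi_simps by (simp add: B_def mat_simps)
      then have "cj (chi i) = (-\<i>) \<cdot>\<^sub>m (cj (B i) * cj last_chi)"
        using cj_smult[OF mult_carrier_mat[OF B_carrier[OF 1] lc]] cj_mult[OF B_carrier[OF 1] lc] by simp
      then show ?thesis
        by (simp only: big.sign_centralizer_smult big.sign_centralizer_mult cj_B[OF 1] cj_last)
    next
      case 2
      then show ?thesis using cj_kappa by simp
    next
      case 3
      then show ?thesis using cj_last by simp
    qed
  qed
  then show ?thesis
    using lift_commutes_parity[OF hc] by (simp add: big.p_clifford_eq L_def)
qed

text \<open>Cyclicity of the trace moves the first factor of \<open>proj = W * adj W\<close> to the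
  end.\<close>

lemma tr_proj_mult:
  assumes U: "U \<in> p_clifford n chi" and V: "V \<in> p_clifford n chi"
  shows "tr (proj * (U * adj V)) = tr (red U * adj (red V))"
proof -
  note D = p_cliffordD[OF U] p_cliffordD[OF V] p_cliffordD[OF big.p_clifford_adj[OF V]]
  have "tr (proj * (U * adj V)) = tr (W * (adj W * (U * adj V)))"
    using D(2,6) by (simp add: W_proj[symmetric] mat_mult_assoc_dim)
  also have "\<dots> = tr (red (U * adj V))"
    using D(2,6) by (subst tr_mult_comm) (auto simp: red_def mat_mult_assoc_dim)
  also have "red (U * adj V) = red U * adj (red V)"
    using red_mult[OF D(2) D(10,11)] by (simp add: red_adj[OF D(6)])
  finally show ?thesis .
qed

end

section \<open>Averages over phase classes\<close>

definition phase_class :: "complex mat \<Rightarrow> complex mat set" where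
  "phase_class U = {c \<cdot>\<^sub>m U | c. cmod c = 1}"

lemma phase_classes_eq: "phase_classes G = phase_class ` G"
  by (simp add: phase_classes_def phase_class_def)

lemma phase_class_self: "U \<in> phase_class U"
  unfolding phase_class_def by (intro CollectI exI[of _ 1]) (simp add: one_smult_mat)

lemma phase_class_eq_iff: "phase_class U = phase_class V \<longleftrightarrow> (\<exists>c. cmod c = 1 \<and> U = c \<cdot>\<^sub>m V)"
proof
  assume "phase_class U = phase_class V"
  then have "U \<in> phase_class V" using phase_class_self by metis
  then show "\<exists>c. cmod c = 1 \<and> U = c \<cdot>\<^sub>m V" by (auto simp: phase_class_def)
next
  assume "\<exists>c. cmod c = 1 \<and> U = c \<cdot>\<^sub>m V"
  then obtain c where "cmod c = 1" "U = c \<cdot>\<^sub>m V" by blast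
  then show "phase_class U = phase_class V"
    by (simp only: phase_class_def phase_class_smult)
qed

lemma phase_class_rep:
  obtains c where "cmod c = 1" "(SOME V. V \<in> phase_class U) = c \<cdot>\<^sub>m U"
proof -
  have "(SOME V. V \<in> phase_class U) \<in> phase_class U"
    using phase_class_self[of U] by (rule someI)
  then show ?thesis using that by (auto simp: phase_class_def)
qed

text \<open>A surjective homomorphism has fibres of equal size on phase classes, translation by a
  preimage of \<open>h' h\<^sup>\<dagger>\<close> mapping the fibre over \<open>h\<close> injectively into the fibre over \<open>h'\<close>;
  hence it preserves uniform averages.\<close>
lemma frame_avg_hom:
  fixes phi :: "complex mat \<Rightarrow> complex mat"
  assumes fin: "finite (phase_classes G)"
    and surj: "phi ` G = H"
    and G_unitary: "\<And>U. U \<in> G \<Longrightarrow> unitary_mat N U"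
    and H_unitary: "\<And>U. U \<in> H \<Longrightarrow> unitary_mat M U"
    and G_mult: "\<And>U V. U \<in> G \<Longrightarrow> V \<in> G \<Longrightarrow> U * V \<in> G"
    and G_adj: "\<And>U. U \<in> G \<Longrightarrow> adj U \<in> G"
    and G_smult: "\<And>c U. U \<in> G \<Longrightarrow> cmod c = 1 \<Longrightarrow> c \<cdot>\<^sub>m U \<in> G"
    and phi_mult: "\<And>U V. U \<in> G \<Longrightarrow> V \<in> G \<Longrightarrow> phi (U * V) = phi U * phi V"
    and phi_adj: "\<And>U. U \<in> G \<Longrightarrow> phi (adj U) = adj (phi U)"
    and phi_smult: "\<And>c U. U \<in> G \<Longrightarrow> cmod c = 1 \<Longrightarrow> phi (c \<cdot>\<^sub>m U) = c \<cdot>\<^sub>m phi U"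
    and f_phi: "\<And>U V. U \<in> G \<Longrightarrow> V \<in> G \<Longrightarrow> f (U * adj V) = f' (phi U * adj (phi V))"
    and f'_smult: "\<And>c A. A \<in> carrier_mat M M \<Longrightarrow> cmod c = 1 \<Longrightarrow> f' (c \<cdot>\<^sub>m A) = f' A"
  shows "frame_avg G f = frame_avg H f'"
proof -
  \<comment> \<open>The choice of representatives built into \<open>frame_avg\<close>. It is known
    only up to a phase, which the phase invariance of \<open>f'\<close> absorbs.\<close>
  define rep where "rep A = (SOME V. V \<in> A)" for A :: "complex mat set"
  have rep: "\<exists>c. cmod c = 1 \<and> rep (phase_class U) = c \<cdot>\<^sub>m U" for U
    using phase_class_rep[of U] unfolding rep_def by metis
  define Phi where "Phi A = phase_class (phi (rep A))" for A
  have rep_G: "rep A \<in> G" if "A \<in> phase_classes G" for A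
    using that rep G_smult unfolding phase_classes_eq by (metis imageE)
  have rep_class: "phase_class (rep A) = A" if "A \<in> phase_classes G" for A
    using that rep phase_class_eq_iff unfolding phase_classes_eq by (metis imageE)
  have Phi_class: "Phi (phase_class U) = phase_class (phi U)" if U: "U \<in> G" for U
  proof -
    obtain c where "cmod c = 1" "rep (phase_class U) = c \<cdot>\<^sub>m U" using rep by blast
    then show ?thesis
      unfolding Phi_def phase_class_eq_iff using phi_smult[OF U] by auto
  qed
  have phi_H: "phi U \<in> H" if "U \<in> G" for U using surj that by blast
  have Phi_image: "Phi ` phase_classes G = phase_classes H"
    unfolding phase_classes_eq surj[symmetric] image_image
    by (intro image_cong refl) (rule Phi_class)
  have f'_rep: "f' (rep (phase_class U) * adj (rep (phase_class V))) = f' (U * adj V)"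
    if "U \<in> H" "V \<in> H" for U V
  proof -
    obtain c where c: "cmod c = 1" "rep (phase_class U) = c \<cdot>\<^sub>m U" using rep by blast
    obtain d where d: "cmod d = 1" "rep (phase_class V) = d \<cdot>\<^sub>m V" using rep by blast
    note D = unitary_matD[OF H_unitary[OF that(1)]] unitary_matD[OF H_unitary[OF that(2)]]
    have "rep (phase_class U) * adj (rep (phase_class V)) = (c * cnj d) \<cdot>\<^sub>m (U * adj V)"
      using D by (simp add: c d mat_simps mult.commute)
    moreover have "cmod (c * cnj d) = 1" using c d by (simp add: norm_mult)
    ultimately show ?thesis using D by (simp add: f'_smult)
  qed
  define F where "F A B = f' (rep A * adj (rep B))" for A B
  have f_F: "f (rep A * adj (rep B)) = F (Phi A) (Phi B)"
    if "A \<in> phase_classes G" "B \<in> phase_classes G" for A B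
    using that rep_G unfolding F_def Phi_def by (simp add: f'_rep phi_H f_phi)
  define fib where "fib C = {A \<in> phase_classes G. Phi A = C}" for C
  have fin_fib: "finite (fib C)" for C using fin by (simp add: fib_def)
  have fib_le: "card (fib C) \<le> card (fib C')"
    if "C \<in> phase_classes H" "C' \<in> phase_classes H" for C C'
  proof -
    have "C \<in> (\<lambda>h. phase_class (phi h)) ` G" "C' \<in> (\<lambda>h. phase_class (phi h)) ` G"
      using that unfolding phase_classes_eq surj[symmetric] image_image .
    then obtain h h' where h: "h \<in> G" "C = phase_class (phi h)"
      and h': "h' \<in> G" "C' = phase_class (phi h')"
      by blast
    define T where "T = h' * adj h"
    have T: "T \<in> G" unfolding T_def using h h' by (intro G_mult G_adj)
    have "inj_on (\<lambda>A. phase_class (T * rep A)) (fib C)"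
    proof (rule inj_onI)
      fix A B assume AB: "A \<in> fib C" "B \<in> fib C"
        "phase_class (T * rep A) = phase_class (T * rep B)"
      have G: "A \<in> phase_classes G" "B \<in> phase_classes G" using AB by (auto simp: fib_def)
      note D = unitary_matD[OF G_unitary[OF T]] unitary_matD[OF G_unitary[OF rep_G[OF G(1)]]]
        unitary_matD[OF G_unitary[OF rep_G[OF G(2)]]]
      obtain c where c: "cmod c = 1" "T * rep A = c \<cdot>\<^sub>m (T * rep B)"
        using AB(3) unfolding phase_class_eq_iff by blast
      have "adj T * (T * rep A) = adj T * (c \<cdot>\<^sub>m (T * rep B))" by (simp only: c)
      then have "rep A = c \<cdot>\<^sub>m rep B"
        using D by (simp add: mult_inverse_cancel[OF D(5)] smult_mult_right_dim)
      then have "phase_class (rep A) = phase_class (rep B)"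
        unfolding phase_class_eq_iff using c(1) by blast
      then show "A = B" by (simp only: rep_class[OF G(1)] rep_class[OF G(2)])
    qed
    moreover have "(\<lambda>A. phase_class (T * rep A)) ` fib C \<subseteq> fib C'"
    proof (rule image_subsetI)
      fix A assume "A \<in> fib C"
      then have A: "A \<in> phase_classes G" "Phi A = C" by (auto simp: fib_def)
      note R = rep_G[OF A(1)]
      obtain c where c: "cmod c = 1" "phi (rep A) = c \<cdot>\<^sub>m phi h"
        using A(2) unfolding h(2) Phi_def phase_class_eq_iff by blast
      note D = unitary_matD[OF H_unitary[OF phi_H[OF h(1)]]]
        unitary_matD[OF H_unitary[OF phi_H[OF h'(1)]]]
      have "phi (T * rep A) = phi h' * adj (phi h) * (c \<cdot>\<^sub>m phi h)"
        using T R h h' by (simp add: phi_mult T_def G_adj phi_adj c)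
      also have "\<dots> = c \<cdot>\<^sub>m phi h'"
        using D by (simp add: mat_simps)
      finally have "Phi (phase_class (T * rep A)) = C'"
        unfolding Phi_class[OF G_mult[OF T R]] h'(2) phase_class_eq_iff using c(1) by blast
      then show "phase_class (T * rep A) \<in> fib C'"
        using G_mult[OF T R] by (simp add: fib_def phase_classes_eq)
    qed
    ultimately show ?thesis using fin_fib by (rule card_inj_on_le)
  qed
  \<comment> \<open>The common fibre size. The default 1 keeps \<open>k\<close> positive when there
    are no classes, so that it can be cancelled at the end.\<close>
  define k where "k = (if phase_classes H = {} then 1 else card (fib (SOME C. C \<in> phase_classes H)))"
  have k: "card (fib C) = k" if C: "C \<in> phase_classes H" for C
  proof -
    have "(SOME C. C \<in> phase_classes H) \<in> phase_classes H" using C by (rule someI)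
    then show ?thesis using C fib_le unfolding k_def by (metis empty_iff le_antisym)
  qed
  have k0: "k > 0"
  proof (cases "phase_classes H = {}")
    case True
    then show ?thesis by (simp add: k_def)
  next
    case False
    then obtain C where C: "C \<in> phase_classes H" by blast
    then have "C \<in> Phi ` phase_classes G" by (simp only: Phi_image)
    then have "fib C \<noteq> {}" by (auto simp: fib_def)
    then show ?thesis using k[OF C] fin_fib[of C] by (simp add: card_gt_0_iff flip: k[OF C])
  qed
  have sum_Phi: "(\<Sum>A\<in>phase_classes G. g (Phi A)) = real k * (\<Sum>C\<in>phase_classes H. g C)"
    for g :: "complex mat set \<Rightarrow> real"
  proof -
    have "(\<Sum>A\<in>phase_classes G. g (Phi A))
        = (\<Sum>C\<in>phase_classes H. \<Sum>A\<in>fib C. g (Phi A))"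
      unfolding fib_def Phi_image[symmetric] by (rule sum.image_gen[OF fin])
    also have "\<dots> = (\<Sum>C\<in>phase_classes H. real k * g C)"
    proof (rule sum.cong[OF refl])
      fix C assume C: "C \<in> phase_classes H"
      have "(\<Sum>A\<in>fib C. g (Phi A)) = (\<Sum>A\<in>fib C. g C)"
        by (intro sum.cong) (auto simp: fib_def)
      then show "(\<Sum>A\<in>fib C. g (Phi A)) = real k * g C" by (simp add: k[OF C])
    qed
    finally show ?thesis by (simp add: sum_distrib_left)
  qed
  have card: "real (card (phase_classes G)) = real k * real (card (phase_classes H))"
    using sum_Phi[of "\<lambda>_. 1"] by simp
  have "(\<Sum>A\<in>phase_classes G. \<Sum>B\<in>phase_classes G. f (rep A * adj (rep B)))
      = (\<Sum>A\<in>phase_classes G. \<Sum>B\<in>phase_classes G. F (Phi A) (Phi B))"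
    by (intro sum.cong refl f_F)
  \<comment> \<open>Each of the two sums contributes a factor \<open>k\<close>, matching the square
    of the number of classes in the denominator.\<close>
  also have "\<dots> = (real k)\<^sup>2 * (\<Sum>C\<in>phase_classes H. \<Sum>C'\<in>phase_classes H. F C C')"
    by (simp add: sum_Phi sum_Phi[of "\<lambda>C. \<Sum>C'\<in>phase_classes H. F C C'"]
        power2_eq_square flip: sum_distrib_left)
  finally show ?thesis
    unfolding frame_avg_def using k0
    by (simp add: card power_mult_distrib F_def flip: rep_def)
qed

theorem mainTheorem16:
  fixes n t :: nat and chi chi' :: "nat \<Rightarrow> complex mat"
  assumes "n \<ge> 2" and "t \<ge> 1"
    and "majorana_family n chi" and "majorana_family (n - 1) chi'"
  shows "frame_potential_plus t (Pi_plus n chi) (p_clifford n chi)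
         = frame_potential t (majorana_clifford (n - 1) chi')"
proof -
  define m where "m = n - 1"
  interpret big: irreducible_majorana n chi
    using assms(3) by (rule irreducible_majoranaI)
  interpret small: irreducible_majorana m chi'
    using assms(4) unfolding m_def by (rule irreducible_majoranaI)
  interpret parity_reduction n m chi chi'
    by unfold_locales (use assms(1) in \<open>simp add: m_def\<close>)
  obtain W where "W \<in> carrier_mat (2 ^ n) (2 ^ m)" "adj W * W = 1\<^sub>m (2 ^ m)"
    "W * adj W = proj" "\<And>i. i \<in> {1..2*m} \<Longrightarrow> B i * W = W * chi' i"
    by (rule isometry_exists) blast
  then interpret parity_isometry n m chi chi' W
    by unfold_locales
  have Pi: "Pi_plus n chi = proj"
    by (simp add: Pi_plus_def proj_def big.parity_def)
  have "red ` p_clifford n chi = majorana_clifford m chi'"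
  proof (intro equalityI image_subsetI red_clifford subsetI)
    fix h assume h: "h \<in> majorana_clifford m chi'"
    then have "h = red (lift h)"
      using red_lift[OF unitary_matD(1)[OF small.clifford_unitary[OF h]]] by simp
    then show "h \<in> red ` p_clifford n chi" using lift_p_clifford[OF h] by (rule image_eqI)
  qed
  then show ?thesis
    unfolding frame_potential_plus_def frame_potential_def Pi m_def[symmetric]
    by (intro frame_avg_hom[where phi = red and N = "2 ^ n" and M = "2 ^ m"])
      (auto simp: big.finite_phase_classes_p_clifford p_cliffordD small.clifford_unitary
        big.p_clifford_mult big.p_clifford_adj big.p_clifford_smult red_mult red_adj red_smult
        tr_proj_mult tr_smult norm_mult)
qed

end
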